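(* Let $\phi:\mathbb{U}\to\mathbb{U}$ be analytic and let $\psi$ be analytic on $\mathbb{U}$ such that $W_{\psi,\phi}$ is a unitary operator on $H^2(\mathbb{U})$ (in which case $\phi$ is an automorphism of $\mathbb{U}$). (a) If $\phi$ is elliptic, fixing $p\in\mathbb{U}$, then $|\phi'(p)|=1$ and the spectrum of $W_{\psi,\phi}$ is the closure of $\{\psi(p)\phi'(p)^n : n=0,1,2,\ldots\}$. (b) If $\phi$ is hyperbolic or parabolic, then the spectrum of $W_{\psi,\phi}$ is the unit circle.
   Context: $\mathbb{U}$ is the open unit disc in $\mathbb{C}$. $H^2(\mathbb{U})$ is the Hardy space of analytic functions on $\mathbb{U}$ with square-summable Maclaurin coefficients, a Hilbert space with inner product $\langle f,g\rangle=\sum_{n\ge 0}\hat f(n)\overline{\hat g(n)}$, where $\hat f(n)$ are the Maclaurin coefficients. The weighted composition operator is $W_{\psi,\phi}f=\psi\cdot(f\circ\phi)$. An automorphism $\phi$ of $\mathbb{U}$ (a bijective analytic map of $\mathbb{U}$ onto itself) is elliptic if it fixes a point of $\mathbb{U}$. If $\phi$ is not elliptic, it has a Denjoy-Wolff point $\omega\in\partial\mathbb{U}$ (the point with $\phi^{[n]}(z)\to\omega$ for every $z\in\mathbb{U}$, where $\phi^{[n]}$ is the $n$-th iterate), with $\phi(\omega)=\omega$ and $0<\phi'(\omega)\le 1$; $\phi$ is hyperbolic if $\phi'(\omega)<1$ and parabolic if $\phi'(\omega)=1$. *)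

theory Defs
  imports "HOL-Complex_Analysis.Complex_Analysis"
begin

abbreviation unit_disc :: "complex set" where
  "unit_disc \<equiv> ball 0 1"

abbreviation maclaurin :: "(complex \<Rightarrow> complex) \<Rightarrow> nat \<Rightarrow> complex" where
  "maclaurin f \<equiv> fps_nth (fps_expansion f 0)"

text \<open>
  The clause \<open>f z = 0\<close> off the disc only selects one representative for each function on the disc,
  so that equality in HOL of elements of \<open>H2\<close> is equality of functions on the disc.
\<close>
definition H2 :: "(complex \<Rightarrow> complex) set" where
  "H2 = {f. f holomorphic_on unit_disc \<and> summable (\<lambda>n. (cmod (maclaurin f n))\<^sup>2)
          \<and> (\<forall>z. z \<notin> unit_disc \<longrightarrow> f z = 0)}"

definition H2_inner :: "(complex \<Rightarrow> complex) \<Rightarrow> (complex \<Rightarrow> complex) \<Rightarrow> complex" where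
  "H2_inner f g = (\<Sum>n. maclaurin f n * cnj (maclaurin g n))"

definition H2_norm :: "(complex \<Rightarrow> complex) \<Rightarrow> real" where
  "H2_norm f = sqrt (Re (H2_inner f f))"

text \<open>
  Operators on \<open>H2\<close> are HOL functions on all of \<open>complex \<Rightarrow> complex\<close>;
  only their restriction to \<open>H2\<close> is relevant below.
\<close>
definition H2_bounded_op :: "((complex \<Rightarrow> complex) \<Rightarrow> complex \<Rightarrow> complex) \<Rightarrow> bool" where
  "H2_bounded_op T \<longleftrightarrow>
     (\<forall>f\<in>H2. T f \<in> H2)
   \<and> (\<forall>f\<in>H2. \<forall>g\<in>H2. T (\<lambda>z. f z + g z) = (\<lambda>z. T f z + T g z))
   \<and> (\<forall>c. \<forall>f\<in>H2. T (\<lambda>z. c * f z) = (\<lambda>z. c * T f z))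
   \<and> (\<exists>K. \<forall>f\<in>H2. H2_norm (T f) \<le> K * H2_norm f)"

definition H2_inverse_ops ::
  "((complex \<Rightarrow> complex) \<Rightarrow> complex \<Rightarrow> complex) \<Rightarrow> ((complex \<Rightarrow> complex) \<Rightarrow> complex \<Rightarrow> complex) \<Rightarrow> bool" where
  "H2_inverse_ops T S \<longleftrightarrow> (\<forall>f\<in>H2. S (T f) = f \<and> T (S f) = f)"

definition H2_adjoint_ops ::
  "((complex \<Rightarrow> complex) \<Rightarrow> complex \<Rightarrow> complex) \<Rightarrow> ((complex \<Rightarrow> complex) \<Rightarrow> complex \<Rightarrow> complex) \<Rightarrow> bool" where
  "H2_adjoint_ops T S \<longleftrightarrow> (\<forall>f\<in>H2. \<forall>g\<in>H2. H2_inner (T f) g = H2_inner f (S g))"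

definition H2_unitary :: "((complex \<Rightarrow> complex) \<Rightarrow> complex \<Rightarrow> complex) \<Rightarrow> bool" where
  "H2_unitary T \<longleftrightarrow> H2_bounded_op T
     \<and> (\<exists>S. H2_bounded_op S \<and> H2_adjoint_ops T S \<and> H2_inverse_ops T S)"

definition H2_spectrum :: "((complex \<Rightarrow> complex) \<Rightarrow> complex \<Rightarrow> complex) \<Rightarrow> complex set" where
  "H2_spectrum T =
     {c. \<not> (\<exists>S. H2_bounded_op S \<and> H2_inverse_ops (\<lambda>f z. c * f z - T f z) S)}"

definition weighted_comp ::
  "(complex \<Rightarrow> complex) \<Rightarrow> (complex \<Rightarrow> complex) \<Rightarrow> (complex \<Rightarrow> complex) \<Rightarrow> complex \<Rightarrow> complex" where
  "weighted_comp \<psi> \<phi> f = (\<lambda>z. if z \<in> unit_disc then \<psi> z * f (\<phi> z) else 0)"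

definition disc_automorphism :: "(complex \<Rightarrow> complex) \<Rightarrow> bool" where
  "disc_automorphism \<phi> \<longleftrightarrow> \<phi> holomorphic_on unit_disc \<and> bij_betw \<phi> unit_disc unit_disc"

definition elliptic :: "(complex \<Rightarrow> complex) \<Rightarrow> bool" where
  "elliptic \<phi> \<longleftrightarrow> disc_automorphism \<phi> \<and> (\<exists>p\<in>unit_disc. \<phi> p = p)"

definition denjoy_wolff_point :: "(complex \<Rightarrow> complex) \<Rightarrow> complex \<Rightarrow> bool" where
  "denjoy_wolff_point \<phi> \<omega> \<longleftrightarrow>
     \<omega> \<in> sphere 0 1 \<and> (\<forall>z\<in>unit_disc. (\<lambda>n. (\<phi> ^^ n) z) \<longlonglongrightarrow> \<omega>)"

text \<open>
  The HOL function \<open>\<phi>\<close> carries no information on the unit circle, so \<open>\<phi>(\<omega>) = \<omega>\<close> and \<open>\<phi>'(\<omega>) = d\<close>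
  are expressed by the limit of the difference quotient from inside the disc (which forces
  \<open>\<phi> z\<close> to tend to \<open>\<omega>\<close>). An automorphism extends analytically across the circle,
  so this is the derivative of the extension at \<open>\<omega>\<close>.
\<close>
definition has_boundary_fixpoint_deriv :: "(complex \<Rightarrow> complex) \<Rightarrow> complex \<Rightarrow> complex \<Rightarrow> bool" where
  "has_boundary_fixpoint_deriv \<phi> \<omega> d \<longleftrightarrow>
     ((\<lambda>z. (\<phi> z - \<omega>) / (z - \<omega>)) \<longlongrightarrow> d) (at \<omega> within unit_disc)"

definition hyperbolic :: "(complex \<Rightarrow> complex) \<Rightarrow> bool" where
  "hyperbolic \<phi> \<longleftrightarrow> disc_automorphism \<phi> \<and> \<not> elliptic \<phi>
     \<and> (\<exists>\<omega>. denjoy_wolff_point \<phi> \<omega>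
          \<and> (\<exists>d::real. d < 1 \<and> has_boundary_fixpoint_deriv \<phi> \<omega> (of_real d)))"

definition parabolic :: "(complex \<Rightarrow> complex) \<Rightarrow> bool" where
  "parabolic \<phi> \<longleftrightarrow> disc_automorphism \<phi> \<and> \<not> elliptic \<phi>
     \<and> (\<exists>\<omega>. denjoy_wolff_point \<phi> \<omega> \<and> has_boundary_fixpoint_deriv \<phi> \<omega> 1)"

end

theory Submission
  imports Defs
begin

text \<open>
  The Szego kernels \<open>K\<^sub>w z = 1 / (1 - cnj w * z)\<close> reproduce point values, so a unitary \<open>W\<close>
  sends its adjoint image \<open>cnj (\<psi> w) K\<^sub>u\<close> of \<open>K\<^sub>w\<close>, where \<open>u = \<phi> w\<close>, back to \<open>K\<^sub>w\<close>, that is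
  \<open>\<psi> z * cnj (\<psi> w) * (1 - z * cnj w) = 1 - \<phi> z * cnj (\<phi> w)\<close>.
  This identity determines \<open>\<phi>\<close> as a disc automorphism and gives
  \<open>|\<psi> z|\<^sup>2 (1 - |z|\<^sup>2) = 1 - |\<phi> z|\<^sup>2\<close>. The spectrum lies on the circle by the Neumann series.

  If \<open>\<phi> p = p\<close>, the functions \<open>((z - p) / (1 - cnj p * z)) ^ n / (1 - cnj p * z)\<close> are
  eigenvectors with eigenvalues \<open>\<psi> p * \<phi>' p ^ n\<close>. These are dense in the circle unless
  \<open>\<phi>' p\<close> is a root of unity, of order \<open>N\<close> say; then \<open>W ^ N\<close> is the scalar \<open>\<psi> p ^ N\<close>, and
  the spectrum consists of the \<open>N\<close>-th roots of that scalar.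

  If \<open>\<phi>\<close> has no fixed point in the disc and \<open>c - W\<close> were invertible with \<open>|c| = 1\<close>, then for
  every \<open>f\<close> the solution \<open>g\<close> of \<open>c g - W g = f\<close> would satisfy
  \<open>|g z|\<^sup>2 (1 - |z|\<^sup>2) \<rightarrow> 0\<close> at the circle. Iterating the equation along the orbit of \<open>0\<close> in
  both directions, which converges to the circle, yields \<open>\<Sum>\<^sub>j c\<^sup>-\<^sup>j (W\<^sup>j f) 0 = 0\<close> (sum over
  all integers). A polynomial \<open>f\<close> that is tiny at all orbit points other than \<open>0\<close> contradicts this.
\<close>

section \<open>The Hardy space\<close>

lemma maclaurin_sums:
  assumes "f holomorphic_on ball 0 r" "cmod z < r"
  shows "(\<lambda>n. maclaurin f n * z ^ n) sums f z"
  using holomorphic_power_series[of f 0 r z] assms by (simp add: fps_expansion_def)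

lemma maclaurin_cong:
  assumes "\<And>z. z \<in> unit_disc \<Longrightarrow> f z = g z"
  shows "maclaurin f n = maclaurin g n"
proof -
  have "\<forall>\<^sub>F w in nhds 0. w \<in> unit_disc"
    by (rule eventually_nhds_in_open) auto
  then have "fps_expansion f 0 = fps_expansion g 0"
    by (intro fps_expansion_cong) (auto elim!: eventually_mono intro: assms)
  then show ?thesis
    by simp
qed

lemma maclaurin_eqI:
  assumes "\<And>z. z \<in> unit_disc \<Longrightarrow> (\<lambda>n. a n * z ^ n) sums f z"
  shows "maclaurin f n = a n" and "f holomorphic_on unit_disc"
proof -
  show hol: "f holomorphic_on unit_disc"
    using power_series_holomorphic[of 0 1 a f] assms by simp
  have "(\<lambda>z. f z) has_fps_expansion Abs_fps a"
    unfolding has_fps_expansion_def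
  proof
    show "0 < fps_conv_radius (Abs_fps a)"
    proof -
      have "summable (\<lambda>n. a n * (1/2) ^ n)"
        using assms[of "1/2"] by (auto simp: sums_iff)
      then have "conv_radius a \<ge> ereal (norm (1/2 :: complex))"
        by (intro conv_radius_geI) auto
      then show ?thesis
        unfolding fps_conv_radius_def
        by (simp add: less_le_trans[of 0 "ereal (1/2)"])
    qed
    have "\<forall>\<^sub>F w::complex in nhds 0. w \<in> unit_disc"
      by (rule eventually_nhds_in_open) auto
    then show "\<forall>\<^sub>F z in nhds 0. eval_fps (Abs_fps a) z = f z"
      by eventually_elim (use assms in \<open>auto simp: eval_fps_def sums_iff\<close>)
  qed
  then show "maclaurin f n = a n"
    using fps_expansion_eqI[of f "Abs_fps a"] by simp
qed

lemma H2I: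
  assumes "f holomorphic_on unit_disc" "summable (\<lambda>n. (cmod (maclaurin f n))\<^sup>2)"
    "\<And>z. z \<notin> unit_disc \<Longrightarrow> f z = 0"
  shows "f \<in> H2"
  using assms by (auto simp: H2_def)

lemma H2_outside: "f \<in> H2 \<Longrightarrow> z \<notin> unit_disc \<Longrightarrow> f z = 0"
  by (auto simp: H2_def)

lemma H2_sums:
  assumes "f \<in> H2" "z \<in> unit_disc"
  shows "(\<lambda>n. maclaurin f n * z ^ n) sums f z"
  using assms maclaurin_sums[of f 1 z] by (auto simp: H2_def)

lemma H2_eqI:
  assumes "f \<in> H2" "g \<in> H2" "\<And>z. z \<in> unit_disc \<Longrightarrow> f z = g z"
  shows "f = g"
  using assms H2_outside by (metis ext)

lemma H2_norm_eq:
  assumes "f \<in> H2"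
  shows "H2_norm f = sqrt (\<Sum>n. (cmod (maclaurin f n))\<^sup>2)"
proof -
  have "summable (\<lambda>n. (cmod (maclaurin f n))\<^sup>2)"
    using assms by (simp add: H2_def)
  then have "(\<lambda>n. complex_of_real ((cmod (maclaurin f n))\<^sup>2))
      sums complex_of_real (\<Sum>n. (cmod (maclaurin f n))\<^sup>2)"
    by (intro sums_of_real summable_sums)
  then show ?thesis
    by (simp add: H2_norm_def H2_inner_def complex_norm_square sums_iff flip: of_real_power)
qed

lemma L2_set_le_H2_norm:
  assumes "f \<in> H2"
  shows "L2_set (\<lambda>n. cmod (maclaurin f n)) {..<M} \<le> H2_norm f"
  unfolding H2_norm_eq[OF assms] L2_set_def
  using assms by (intro real_sqrt_le_mono sum_le_suminf) (auto simp: H2_def)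

text \<open>Norms are estimated through finite truncations \<open>L2_set\<close>, so that Minkowski
  and Cauchy-Schwarz are needed only for finite sums. This lemma passes from a uniform bound on the
  truncations to the infinite sum.\<close>

lemma summable_if_L2_set_le:
  assumes "\<And>M. L2_set (\<lambda>n. cmod (a n)) {..<M} \<le> C"
  shows "summable (\<lambda>n. (cmod (a n))\<^sup>2)" and "sqrt (\<Sum>n. (cmod (a n))\<^sup>2) \<le> C"
proof -
  have C: "0 \<le> C"
    using assms[of 0] by simp
  have le: "(\<Sum>n<M. (cmod (a n))\<^sup>2) \<le> C\<^sup>2" for M
    using assms[of M] C real_sqrt_le_iff[of "\<Sum>n<M. (cmod (a n))\<^sup>2" "C\<^sup>2"]
    by (simp add: L2_set_def)
  show summ: "summable (\<lambda>n. (cmod (a n))\<^sup>2)"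
    by (rule bounded_imp_summable[where B = "C\<^sup>2"])
      (use le[of "Suc _"] in \<open>auto simp: lessThan_Suc_atMost\<close>)
  show "sqrt (\<Sum>n. (cmod (a n))\<^sup>2) \<le> C"
    using suminf_le_const[OF summ le] C real_sqrt_le_iff[of "\<Sum>n. (cmod (a n))\<^sup>2" "C\<^sup>2"] by simp
qed

lemma H2_norm_le:
  assumes "f \<in> H2" "\<And>M. L2_set (\<lambda>n. cmod (maclaurin f n)) {..<M} \<le> C"
  shows "H2_norm f \<le> C"
  using assms summable_if_L2_set_le(2)[of "maclaurin f" C] by (simp add: H2_norm_eq)

lemma H2_norm_nonneg: "f \<in> H2 \<Longrightarrow> 0 \<le> H2_norm f"
  using L2_set_le_H2_norm[of f 0] by simp

lemma maclaurin_le_H2_norm: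
  assumes "f \<in> H2"
  shows "cmod (maclaurin f n) \<le> H2_norm f"
  using member_le_L2_set[of "{..<Suc n}" n "\<lambda>n. cmod (maclaurin f n)"]
    L2_set_le_H2_norm[OF assms, of "Suc n"] by simp

lemma bounded_coeff_summable:
  assumes "\<And>n. cmod (a n) \<le> C" "cmod z < 1"
  shows "summable (\<lambda>n. cmod (a n * z ^ n))"
proof (rule summable_comparison_test')
  show "summable (\<lambda>n. C * cmod z ^ n)"
    using assms by (intro summable_mult summable_geometric) auto
  show "norm (cmod (a n * z ^ n)) \<le> C * cmod z ^ n" for n
    using assms by (simp add: norm_mult norm_power mult_right_mono)
qed

text \<open>The source of new elements of the space: a square-summable sequence is bounded, so its
  power series converges on the disc. It takes the place of an abstract completeness
  argument.\<close>

lemma H2_from_coeffs: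
  assumes "\<And>M. L2_set (\<lambda>n. cmod (a n)) {..<M} \<le> C"
  obtains f where "f \<in> H2" "\<And>n. maclaurin f n = a n" "H2_norm f \<le> C"
    "\<And>z. z \<in> unit_disc \<Longrightarrow> (\<lambda>n. a n * z ^ n) sums f z"
proof -
  define f where "f z = (if z \<in> unit_disc then \<Sum>n. a n * z ^ n else 0)" for z
  have "cmod (a n) \<le> C" for n
    using member_le_L2_set[of "{..<Suc n}" n "\<lambda>n. cmod (a n)"] assms[of "Suc n"] by simp
  then have sums: "(\<lambda>n. a n * z ^ n) sums f z" if "z \<in> unit_disc" for z
    using that summable_norm_cancel[OF bounded_coeff_summable[of a C z]]
    by (simp add: f_def summable_sums)
  have mac: "maclaurin f n = a n" and hol: "f holomorphic_on unit_disc" for n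
    using maclaurin_eqI[OF sums] by auto
  have "f \<in> H2"
    using summable_if_L2_set_le(1)[of a C, OF assms] hol
    by (intro H2I) (simp_all add: mac f_def)
  then show thesis
    using that[of f] H2_norm_le[of f C] assms sums by (simp add: mac)
qed

section \<open>The linear structure of the Hardy space\<close>

lemma H2_add:
  assumes "f \<in> H2" "g \<in> H2"
  shows "(\<lambda>z. f z + g z) \<in> H2" "maclaurin (\<lambda>z. f z + g z) n = maclaurin f n + maclaurin g n"
    "H2_norm (\<lambda>z. f z + g z) \<le> H2_norm f + H2_norm g"
proof -
  let ?h = "\<lambda>z. f z + g z"
  have s: "(\<lambda>n. (maclaurin f n + maclaurin g n) * z ^ n) sums ?h z" if "z \<in> unit_disc" for z
    using sums_add[OF H2_sums[OF assms(1) that] H2_sums[OF assms(2) that]]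
    by (simp add: ring_distribs)
  have mac: "maclaurin ?h n = maclaurin f n + maclaurin g n" for n
    using maclaurin_eqI(1)[OF s] .
  have hol: "?h holomorphic_on unit_disc"
    using maclaurin_eqI(2)[OF s] .
  have L: "L2_set (\<lambda>n. cmod (maclaurin ?h n)) {..<M} \<le> H2_norm f + H2_norm g" for M
  proof -
    have "L2_set (\<lambda>n. cmod (maclaurin ?h n)) {..<M}
        \<le> L2_set (\<lambda>n. cmod (maclaurin f n) + cmod (maclaurin g n)) {..<M}"
      unfolding mac by (intro L2_set_mono norm_triangle_ineq) auto
    also have "\<dots> \<le> H2_norm f + H2_norm g"
      by (rule order_trans[OF L2_set_triangle_ineq])
        (intro add_mono L2_set_le_H2_norm assms)
    finally show ?thesis .
  qed
  show "?h \<in> H2"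
    using summable_if_L2_set_le(1)[OF L] hol H2_outside[OF assms(1)] H2_outside[OF assms(2)]
    by (intro H2I) auto
  then show "H2_norm ?h \<le> H2_norm f + H2_norm g"
    by (rule H2_norm_le[OF _ L])
  show "maclaurin ?h n = maclaurin f n + maclaurin g n"
    by (rule mac)
qed

lemma H2_cmult:
  assumes "f \<in> H2"
  shows "(\<lambda>z. c * f z) \<in> H2" "maclaurin (\<lambda>z. c * f z) n = c * maclaurin f n"
    "H2_norm (\<lambda>z. c * f z) = cmod c * H2_norm f"
proof -
  let ?h = "\<lambda>z. c * f z"
  have s: "(\<lambda>n. (c * maclaurin f n) * z ^ n) sums ?h z" if "z \<in> unit_disc" for z
    using sums_mult[OF H2_sums[OF assms(1) that]] by (simp add: mult.assoc)
  have mac: "maclaurin ?h n = c * maclaurin f n" for n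
    using maclaurin_eqI(1)[OF s] .
  have hol: "?h holomorphic_on unit_disc"
    using maclaurin_eqI(2)[OF s] .
  have summ: "summable (\<lambda>n. (cmod (maclaurin f n))\<^sup>2)"
    using assms by (simp add: H2_def)
  then have "summable (\<lambda>n. (cmod (maclaurin ?h n))\<^sup>2)"
    by (simp add: mac norm_mult power_mult_distrib summable_mult)
  then show h: "?h \<in> H2"
    using hol H2_outside[OF assms(1)] by (intro H2I) auto
  show "H2_norm ?h = cmod c * H2_norm f"
    unfolding H2_norm_eq[OF h] H2_norm_eq[OF assms]
    using summ by (simp add: mac norm_mult power_mult_distrib suminf_mult real_sqrt_mult)
  show "maclaurin ?h n = c * maclaurin f n"
    by (rule mac)
qed

lemma H2_diff:
  assumes "f \<in> H2" "g \<in> H2"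
  shows "(\<lambda>z. f z - g z) \<in> H2"
  using H2_add(1)[OF assms(1) H2_cmult(1)[OF assms(2), of "-1"]] by simp

lemma H2_zero: "(\<lambda>z. 0) \<in> H2" "H2_norm (\<lambda>z. 0) = 0" "maclaurin (\<lambda>z. 0) n = 0"
proof -
  have s: "(\<lambda>n. 0 * z ^ n) sums (0::complex)" for z :: complex
    by simp
  have mac: "maclaurin (\<lambda>z. 0) n = 0" for n
    using maclaurin_eqI(1)[OF s] by simp
  then show "maclaurin (\<lambda>z. 0) n = 0" .
  show "(\<lambda>z. 0) \<in> H2"
    by (intro H2I) (auto simp: mac)
  then show "H2_norm (\<lambda>z. 0) = 0"
    by (simp add: H2_norm_eq mac)
qed

lemma H2_sum:
  assumes "\<And>i. i \<in> A \<Longrightarrow> F i \<in> H2"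
  shows "(\<lambda>z. \<Sum>i\<in>A. F i z) \<in> H2" "H2_norm (\<lambda>z. \<Sum>i\<in>A. F i z) \<le> (\<Sum>i\<in>A. H2_norm (F i))"
    "maclaurin (\<lambda>z. \<Sum>i\<in>A. F i z) n = (\<Sum>i\<in>A. maclaurin (F i) n)"
  using assms
proof (induction A rule: infinite_finite_induct)
  case (insert x A)
  {
    case 1
    then show ?case
      using insert H2_add(1)[of "F x" "\<lambda>z. \<Sum>i\<in>A. F i z"] by simp
  next
    case 2
    then show ?case
      using insert H2_add(3)[of "F x" "\<lambda>z. \<Sum>i\<in>A. F i z"] by fastforce
  next
    case 3
    then show ?case
      using insert H2_add(2)[of "F x" "\<lambda>z. \<Sum>i\<in>A. F i z"] by simp
  }
qed (simp_all add: H2_zero)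

text \<open>Cauchy-Schwarz applied to the coefficients of \<open>f\<close> and the sequence
  \<open>z ^ n\<close>, whose l2 norm is \<open>1 / sqrt (1 - (cmod z)\<^sup>2)\<close>.\<close>

lemma H2_pointwise_bound:
  assumes f: "f \<in> H2" and z: "z \<in> unit_disc"
  shows "cmod (f z) * sqrt (1 - (cmod z)\<^sup>2) \<le> H2_norm f"
proof -
  have z1: "(cmod z)\<^sup>2 < 1"
    using z by (simp add: abs_square_less_1)
  have geo: "L2_set (\<lambda>n. cmod z ^ n) {..<M} \<le> 1 / sqrt (1 - (cmod z)\<^sup>2)" for M
  proof -
    have "(\<lambda>n. ((cmod z)\<^sup>2) ^ n) sums (1 / (1 - (cmod z)\<^sup>2))"
      using z1 by (intro geometric_sums) auto
    then have "(\<Sum>n<M. ((cmod z)\<^sup>2) ^ n) \<le> 1 / (1 - (cmod z)\<^sup>2)"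
      using sum_le_suminf[of "\<lambda>n. ((cmod z)\<^sup>2) ^ n" "{..<M}"] by (auto simp: sums_iff)
    then show ?thesis
      using real_sqrt_le_mono[of "\<Sum>n<M. ((cmod z)\<^sup>2) ^ n" "1 / (1 - (cmod z)\<^sup>2)"]
      by (simp add: L2_set_def real_sqrt_divide power_mult [symmetric] mult.commute)
  qed
  have "(\<lambda>M. cmod (\<Sum>n<M. maclaurin f n * z ^ n)) \<longlonglongrightarrow> cmod (f z)"
    using H2_sums[OF f z] by (intro tendsto_norm) (simp add: sums_def)
  moreover have "cmod (\<Sum>n<M. maclaurin f n * z ^ n) \<le> H2_norm f / sqrt (1 - (cmod z)\<^sup>2)" for M
  proof -
    have "cmod (\<Sum>n<M. maclaurin f n * z ^ n)
        \<le> (\<Sum>n<M. \<bar>cmod (maclaurin f n)\<bar> * \<bar>cmod z ^ n\<bar>)"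
      by (rule sum_norm_le) (simp add: norm_mult norm_power)
    also have "\<dots> \<le> L2_set (\<lambda>n. cmod (maclaurin f n)) {..<M} * L2_set (\<lambda>n. cmod z ^ n) {..<M}"
      by (rule L2_set_mult_ineq)
    also have "\<dots> \<le> H2_norm f * (1 / sqrt (1 - (cmod z)\<^sup>2))"
      by (intro mult_mono L2_set_le_H2_norm f geo H2_norm_nonneg) auto
    finally show ?thesis
      by simp
  qed
  ultimately have "cmod (f z) \<le> H2_norm f / sqrt (1 - (cmod z)\<^sup>2)"
    by (intro LIMSEQ_le_const2) auto
  then show ?thesis
    using z1 by (simp add: field_simps)
qed

lemma H2_norm_pos:
  assumes "f \<in> H2" "z \<in> unit_disc" "f z \<noteq> 0"
  shows "H2_norm f > 0"
proof -
  have "(cmod z)\<^sup>2 < 1"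
    using assms(2) by (simp add: abs_square_less_1)
  then have "0 < cmod (f z) * sqrt (1 - (cmod z)\<^sup>2)"
    using assms(3) by simp
  then show ?thesis
    using H2_pointwise_bound[OF assms(1,2)] by linarith
qed

text \<open>Convergence of the Maclaurin series at a radius \<open>\<rho>\<close> beyond 1 makes the
  coefficients absolutely summable, and once they are below 1 their squares are smaller still. This
  supplies the eigenvectors and the polynomial test functions.\<close>

lemma H2_restrict:
  assumes f: "f holomorphic_on ball 0 r" and r: "1 < r"
  shows "(\<lambda>z. if z \<in> unit_disc then f z else 0) \<in> H2"
proof (rule H2I)
  let ?g = "\<lambda>z. if z \<in> unit_disc then f z else 0"
  have mac: "maclaurin ?g n = maclaurin f n" for n
    by (rule maclaurin_cong) simp
  obtain \<rho> where \<rho>: "1 < \<rho>" "\<rho> < r"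
    using dense[OF r] by blast
  have "(\<lambda>n. maclaurin f n * of_real \<rho> ^ n) sums f (of_real \<rho>)"
    using \<rho> by (intro maclaurin_sums[OF f]) auto
  then have s: "summable (\<lambda>n. cmod (maclaurin f n))"
    using powser_insidea[of "maclaurin f" "of_real \<rho>" 1] \<rho> by (auto simp: sums_iff)
  show "summable (\<lambda>n. (cmod (maclaurin ?g n))\<^sup>2)"
    unfolding mac
  proof (rule summable_comparison_test_ev[OF _ s])
    have "(\<lambda>n. cmod (maclaurin f n)) \<longlonglongrightarrow> 0"
      by (rule summable_LIMSEQ_zero[OF s])
    then have "\<forall>\<^sub>F n in sequentially. cmod (maclaurin f n) < 1"
      by (rule order_tendstoD(2)) simp
    then show "\<forall>\<^sub>F n in sequentially. norm ((cmod (maclaurin f n))\<^sup>2) \<le> cmod (maclaurin f n)"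
      by eventually_elim (simp add: power2_eq_square mult_left_le_one_le)
  qed
  have "f holomorphic_on unit_disc"
    using r by (intro holomorphic_on_subset[OF f]) auto
  then show "?g holomorphic_on unit_disc"
    by (rule holomorphic_transform) simp
qed simp

text \<open>The pointwise bound alone gives boundedness. For decay, \<open>f\<close> is split into a
  Taylor polynomial, which is bounded on the disc and is killed by the factor tending to 0, and a
  tail of norm at most \<open>e/2\<close>, to which the pointwise bound applies.\<close>

lemma H2_boundary_decay:
  assumes f: "f \<in> H2" and u: "\<And>j. u j \<in> unit_disc" and lim: "((\<lambda>j. cmod (u j)) \<longlongrightarrow> 1) F"
  shows "((\<lambda>j. cmod (f (u j)) * sqrt (1 - (cmod (u j))\<^sup>2)) \<longlongrightarrow> 0) F"
proof (rule tendstoI)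
  fix e :: real
  assume e: "e > 0"
  have "summable (\<lambda>n. (cmod (maclaurin f n))\<^sup>2)"
    using f by (simp add: H2_def)
  then obtain N where N: "norm (\<Sum>n=m..<k. (cmod (maclaurin f n))\<^sup>2) < (e/2)\<^sup>2" if "m \<ge> N" for m k
    using e unfolding summable_Cauchy by (metis half_gt_zero zero_less_power)
  define b where "b n = (if n < N then 0 else maclaurin f n)" for n
  define p where "p z = (\<Sum>n<N. maclaurin f n * z ^ n)" for z
  define A where "A = (\<Sum>n<N. cmod (maclaurin f n))"
  have "L2_set (\<lambda>n. cmod (b n)) {..<M} \<le> e/2" for M
  proof -
    have "(\<Sum>n<M. (cmod (b n))\<^sup>2) = (\<Sum>n=N..<M. (cmod (maclaurin f n))\<^sup>2)"
      by (rule sum.mono_neutral_cong_right) (auto simp: b_def)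
    also have "\<dots> \<le> (e/2)\<^sup>2"
      using N[of N M] by simp
    finally show ?thesis
      using e real_sqrt_le_mono[of _ "(e/2)\<^sup>2"] by (fastforce simp: L2_set_def)
  qed
  then obtain g where g: "g \<in> H2" "H2_norm g \<le> e/2"
    and gs: "\<And>z. z \<in> unit_disc \<Longrightarrow> (\<lambda>n. b n * z ^ n) sums g z"
    by (rule H2_from_coeffs) blast
  have split: "f z = p z + g z" if z: "z \<in> unit_disc" for z
  proof -
    have "(\<lambda>n. maclaurin f n * z ^ n - b n * z ^ n) sums (f z - g z)"
      by (intro sums_diff H2_sums f z gs)
    moreover have "(\<lambda>n. maclaurin f n * z ^ n - b n * z ^ n) sums p z"
      using sums_finite[of "{..<N}" "\<lambda>n. maclaurin f n * z ^ n - b n * z ^ n"]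
      by (simp add: p_def b_def)
    ultimately have "f z - g z = p z"
      using sums_unique2 by blast
    then show ?thesis
      by (simp add: algebra_simps)
  qed
  have head: "cmod (p z) \<le> A" if z: "z \<in> unit_disc" for z
    unfolding p_def A_def
    using z by (intro sum_norm_le) (simp add: norm_mult norm_power mult_left_le power_le_one)
  have A: "A \<ge> 0"
    by (simp add: A_def sum_nonneg)
  have "((\<lambda>j. A * sqrt (1 - (cmod (u j))\<^sup>2)) \<longlongrightarrow> A * sqrt (1 - 1\<^sup>2)) F"
    by (intro tendsto_intros lim)
  then have "\<forall>\<^sub>F j in F. A * sqrt (1 - (cmod (u j))\<^sup>2) < e/2"
    by (rule order_tendstoD(2)) (use e in simp)
  then show "\<forall>\<^sub>F j in F. dist (cmod (f (u j)) * sqrt (1 - (cmod (u j))\<^sup>2)) 0 < e"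
  proof eventually_elim
    case (elim j)
    have s: "sqrt (1 - (cmod (u j))\<^sup>2) \<ge> 0"
      using u[of j] by (simp add: power_le_one)
    have "cmod (f (u j)) * sqrt (1 - (cmod (u j))\<^sup>2)
        \<le> (A + cmod (g (u j))) * sqrt (1 - (cmod (u j))\<^sup>2)"
      unfolding split[OF u]
      by (intro mult_right_mono s order_trans[OF norm_triangle_ineq] add_mono head u order_refl)
    also have "\<dots> < e/2 + e/2"
      unfolding distrib_right
      using elim H2_pointwise_bound[OF g(1) u, of j] g(2) by linarith
    finally show ?case
      using s by (simp add: abs_mult)
  qed
qed

section \<open>Szego kernels and point evaluation\<close>

definition szego_kernel :: "complex \<Rightarrow> complex \<Rightarrow> complex" where
  "szego_kernel w z = (if z \<in> unit_disc then 1 / (1 - cnj w * z) else 0)"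

lemma norm_mult_less_1:
  assumes "z \<in> unit_disc" "cmod w \<le> 1"
  shows "cmod (w * z) < 1"
  using mult_left_le_one_le[of "cmod z" "cmod w"] assms by (simp add: norm_mult)

lemma one_minus_mult_neq_0:
  assumes "z \<in> unit_disc" "cmod w \<le> 1"
  shows "1 - w * z \<noteq> 0" "1 + w * z \<noteq> 0"
  using norm_mult_less_1[OF assms]
  by (auto dest!: arg_cong[of _ _ cmod] simp: add_eq_0_iff)

lemma szego_kernel_H2:
  assumes w: "w \<in> unit_disc"
  shows "szego_kernel w \<in> H2" "maclaurin (szego_kernel w) n = cnj w ^ n"
proof -
  have s: "(\<lambda>n. cnj w ^ n * z ^ n) sums szego_kernel w z" if z: "z \<in> unit_disc" for z
  proof -
    have "cmod (cnj w * z) < 1"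
      using w by (intro norm_mult_less_1 z) simp
    from geometric_sums[OF this] show ?thesis
      using z by (simp add: szego_kernel_def power_mult_distrib)
  qed
  have mac: "maclaurin (szego_kernel w) n = cnj w ^ n" for n
    by (rule maclaurin_eqI(1)[OF s])
  have "summable (\<lambda>n. ((cmod w)\<^sup>2) ^ n)"
    using w by (intro summable_geometric) (simp add: abs_square_less_1)
  then have "summable (\<lambda>n. (cmod (maclaurin (szego_kernel w) n))\<^sup>2)"
    by (simp add: mac norm_power power_mult [symmetric] mult.commute)
  from H2I[OF maclaurin_eqI(2)[OF s] this] show "szego_kernel w \<in> H2"
    by (simp_all add: szego_kernel_def)
  show "maclaurin (szego_kernel w) n = cnj w ^ n"
    by (rule mac)
qed

lemma H2_inner_szego_kernel:
  assumes "f \<in> H2" "w \<in> unit_disc"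
  shows "H2_inner f (szego_kernel w) = f w" "H2_inner (szego_kernel w) f = cnj (f w)"
proof -
  have s: "(\<lambda>n. maclaurin f n * w ^ n) sums f w"
    by (rule H2_sums[OF assms])
  then show "H2_inner f (szego_kernel w) = f w"
    using assms by (simp add: H2_inner_def szego_kernel_H2 sums_iff)
  from s have "(\<lambda>n. cnj (maclaurin f n * w ^ n)) sums cnj (f w)"
    by (simp only: sums_cnj)
  then show "H2_inner (szego_kernel w) f = cnj (f w)"
    using assms by (simp add: H2_inner_def szego_kernel_H2 sums_iff mult.commute)
qed

text \<open>Prepares the Neumann series. The limit \<open>g\<close> is built coefficient by
  coefficient; each truncated norm of a partial sum is below \<open>M / (1 - q)\<close>, and this
  survives the limit because it involves finitely many coefficients.\<close>

lemma H2_geometric_series: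
  assumes F: "\<And>n. F n \<in> H2" and bd: "\<And>n. H2_norm (F n) \<le> M * q ^ n" and q: "0 \<le> q" "q < 1"
  obtains g where "g \<in> H2" "\<And>z. z \<in> unit_disc \<Longrightarrow> (\<lambda>n. F n z) sums g z" "H2_norm g \<le> M / (1 - q)"
proof -
  have M: "M \<ge> 0"
    using bd[of 0] H2_norm_nonneg[OF F, of 0] by simp
  define a where "a n k = maclaurin (F n) k" for n k
  have ale: "cmod (a n k) \<le> M * q ^ n" for n k
    using maclaurin_le_H2_norm[OF F, of n k] bd[of n] by (simp add: a_def)
  have geo: "(\<lambda>n. M * q ^ n) sums (M / (1 - q))"
    using sums_mult[OF geometric_sums[of q], of M] q by simp
  have suma: "summable (\<lambda>n. a n k)" for k
    by (rule summable_comparison_test'[OF sums_summable[OF geo]]) (rule ale)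
  define b where "b k = (\<Sum>n. a n k)" for k
  have blim: "(\<lambda>N. \<Sum>n<N. a n k) \<longlonglongrightarrow> b k" for k
    unfolding b_def by (rule summable_LIMSEQ[OF suma])
  have "L2_set (\<lambda>k. cmod (b k)) {..<K} \<le> M / (1 - q)" for K
  proof (rule LIMSEQ_le_const2)
    show "(\<lambda>N. L2_set (\<lambda>k. cmod (\<Sum>n<N. a n k)) {..<K}) \<longlonglongrightarrow> L2_set (\<lambda>k. cmod (b k)) {..<K}"
      unfolding L2_set_def by (intro tendsto_intros blim)
    have "L2_set (\<lambda>k. cmod (\<Sum>n<N. a n k)) {..<K} \<le> M / (1 - q)" for N
    proof -
      have "L2_set (\<lambda>k. cmod (\<Sum>n<N. a n k)) {..<K} \<le> H2_norm (\<lambda>z. \<Sum>n<N. F n z)"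
        using L2_set_le_H2_norm[OF H2_sum(1)[of "{..<N}" F], of K] F
        by (simp add: H2_sum(3) a_def)
      also have "\<dots> \<le> (\<Sum>n<N. M * q ^ n)"
        by (rule order_trans[OF H2_sum(2)[OF F] sum_mono]) (rule bd)
      also have "\<dots> \<le> M / (1 - q)"
        using sum_le_suminf[OF sums_summable[OF geo], of "{..<N}"] M q sums_unique[OF geo] by simp
      finally show ?thesis .
    qed
    then show "\<exists>N. \<forall>n\<ge>N. L2_set (\<lambda>k. cmod (\<Sum>n<n. a n k)) {..<K} \<le> M / (1 - q)"
      by blast
  qed
  then obtain g where g: "g \<in> H2" "H2_norm g \<le> M / (1 - q)"
    and gs: "\<And>z. z \<in> unit_disc \<Longrightarrow> (\<lambda>k. b k * z ^ k) sums g z"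
    by (rule H2_from_coeffs) blast
  have "(\<lambda>n. F n z) sums g z" if z: "z \<in> unit_disc" for z
  proof -
    have z1: "cmod z < 1"
      using z by simp
    \<comment> \<open>Every coefficient of the remainder is at most
      \<open>M / (1 - q) * q ^ N\<close>, uniformly in \<open>k\<close>; summing against
      \<open>cmod z ^ k\<close> contributes the factor \<open>1 / (1 - cmod z)\<close>.\<close>
    have bound: "cmod ((\<Sum>n<N. F n z) - g z) \<le> M / (1 - q) * (1 / (1 - cmod z)) * q ^ N" for N
    proof -
      define r where "r k = (\<Sum>n<N. a n k) - b k" for k
      have rle: "cmod (r k) \<le> M / (1 - q) * q ^ N" for k
      proof -
        have "b k = (\<Sum>n. a (n + N) k) + (\<Sum>n<N. a n k)"
          unfolding b_def by (rule suminf_split_initial_segment[OF suma])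
        then have "cmod (r k) = cmod (\<Sum>n. a (n + N) k)"
          by (simp add: r_def)
        also have "\<dots> \<le> (\<Sum>n. M * q ^ n * q ^ N)"
          using ale[of "_ + N" k] sums_summable[OF geo]
          by (intro norm_suminf_le summable_mult2) (simp add: power_add mult.assoc)
        also have "\<dots> = M / (1 - q) * q ^ N"
          using sums_mult2[OF geo, of "q ^ N"] by (simp add: sums_iff)
        finally show ?thesis .
      qed
      have "(\<lambda>k. (\<Sum>n<N. a n k * z ^ k) - b k * z ^ k) sums ((\<Sum>n<N. F n z) - g z)"
        unfolding a_def by (intro sums_diff sums_sum gs z H2_sums F)
      then have s: "(\<lambda>k. r k * z ^ k) sums ((\<Sum>n<N. F n z) - g z)"
        by (simp add: r_def sum_distrib_right left_diff_distrib)
      have geoz: "(\<lambda>k. M / (1 - q) * q ^ N * cmod z ^ k) sums (M / (1 - q) * q ^ N * (1 / (1 - cmod z)))"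
        using z1 by (intro sums_mult geometric_sums) auto
      have "cmod (\<Sum>k. r k * z ^ k) \<le> (\<Sum>k. M / (1 - q) * q ^ N * cmod z ^ k)"
      proof (rule norm_suminf_le[OF _ sums_summable[OF geoz]])
        show "cmod (r k * z ^ k) \<le> M / (1 - q) * q ^ N * cmod z ^ k" for k
          unfolding norm_mult norm_power by (rule mult_right_mono[OF rle]) simp
      qed
      then show ?thesis
        unfolding sums_unique[OF s, symmetric] sums_unique[OF geoz, symmetric]
        by (simp only: mult_ac)
    qed
    have "(\<lambda>N. M / (1 - q) * (1 / (1 - cmod z)) * q ^ N) \<longlonglongrightarrow> M / (1 - q) * (1 / (1 - cmod z)) * 0"
      using q by (intro tendsto_mult tendsto_const LIMSEQ_power_zero) auto
    then have "(\<lambda>N. (\<Sum>n<N. F n z) - g z) \<longlonglongrightarrow> 0"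
      using Lim_null_comparison[OF always_eventually[OF allI[OF bound]]] by simp
    then show ?thesis
      by (simp add: sums_def LIM_zero_iff)
  qed
  with g show thesis
    using that by blast
qed

section \<open>Bounded operators and their spectra\<close>

lemma H2_bounded_opD:
  assumes "H2_bounded_op T"
  shows "f \<in> H2 \<Longrightarrow> T f \<in> H2"
    and "f \<in> H2 \<Longrightarrow> g \<in> H2 \<Longrightarrow> T (\<lambda>z. f z + g z) = (\<lambda>z. T f z + T g z)"
    and "f \<in> H2 \<Longrightarrow> T (\<lambda>z. c * f z) = (\<lambda>z. c * T f z)"
  using assms by (auto simp: H2_bounded_op_def)

lemma H2_bounded_op_bound:
  assumes "H2_bounded_op T"
  obtains K where "0 < K" "\<And>f. f \<in> H2 \<Longrightarrow> H2_norm (T f) \<le> K * H2_norm f"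
proof -
  obtain K where K: "\<forall>f\<in>H2. H2_norm (T f) \<le> K * H2_norm f"
    using assms by (auto simp: H2_bounded_op_def)
  have "H2_norm (T f) \<le> max 1 K * H2_norm f" if "f \<in> H2" for f
    using K that mult_right_mono[OF max.cobounded2[of K 1] H2_norm_nonneg[OF that]]
    by fastforce
  then show thesis
    using that[of "max 1 K"] by simp
qed

lemma H2_bounded_opI:
  assumes "\<And>f. f \<in> H2 \<Longrightarrow> T f \<in> H2"
    and "\<And>f g. f \<in> H2 \<Longrightarrow> g \<in> H2 \<Longrightarrow> T (\<lambda>z. f z + g z) = (\<lambda>z. T f z + T g z)"
    and "\<And>c f. f \<in> H2 \<Longrightarrow> T (\<lambda>z. c * f z) = (\<lambda>z. c * T f z)"
    and "\<And>f. f \<in> H2 \<Longrightarrow> H2_norm (T f) \<le> K * H2_norm f"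
  shows "H2_bounded_op T"
  using assms unfolding H2_bounded_op_def by blast

lemma H2_bounded_op_diff:
  assumes "H2_bounded_op T" "f \<in> H2" "g \<in> H2"
  shows "T (\<lambda>z. f z - g z) = (\<lambda>z. T f z - T g z)"
  using H2_bounded_opD(2)[OF assms(1,2) H2_cmult(1)[OF assms(3), of "-1"]]
    H2_bounded_opD(3)[OF assms(1,3), of "-1"] by simp

lemma H2_bounded_op_sum:
  assumes T: "H2_bounded_op T" and F: "\<And>i. i \<in> A \<Longrightarrow> F i \<in> H2"
  shows "T (\<lambda>z. \<Sum>i\<in>A. F i z) = (\<lambda>z. \<Sum>i\<in>A. T (F i) z)"
proof -
  have zero: "T (\<lambda>z. 0) = (\<lambda>z. 0)"
    using H2_bounded_opD(3)[OF T H2_zero(1), of 0] by simp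
  show ?thesis
    using F
  proof (induction A rule: infinite_finite_induct)
    case (insert x A)
    then show ?case
      using H2_bounded_opD(2)[OF T, of "F x" "\<lambda>z. \<Sum>i\<in>A. F i z"] H2_sum(1)[of A F] by auto
  qed (simp_all add: zero)
qed

lemma H2_bounded_op_id: "H2_bounded_op (\<lambda>f. f)"
  by (rule H2_bounded_opI[where K = 1]) simp_all

lemma H2_bounded_op_compose:
  assumes S: "H2_bounded_op S" and T: "H2_bounded_op T"
  shows "H2_bounded_op (\<lambda>f. S (T f))"
proof -
  obtain K where K: "0 < K" "\<And>f. f \<in> H2 \<Longrightarrow> H2_norm (S f) \<le> K * H2_norm f"
    by (rule H2_bounded_op_bound[OF S]) blast
  obtain L where L: "0 < L" "\<And>f. f \<in> H2 \<Longrightarrow> H2_norm (T f) \<le> L * H2_norm f"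
    by (rule H2_bounded_op_bound[OF T]) blast
  show ?thesis
  proof (rule H2_bounded_opI[where K = "K * L"])
    fix f assume f: "f \<in> H2"
    have "H2_norm (S (T f)) \<le> K * H2_norm (T f)"
      by (intro K(2) H2_bounded_opD(1)[OF T] f)
    also have "\<dots> \<le> K * (L * H2_norm f)"
      using K(1) by (intro mult_left_mono L(2) f) auto
    finally show "H2_norm (S (T f)) \<le> K * L * H2_norm f"
      by (simp add: mult.assoc)
  qed (simp_all add: H2_bounded_opD[OF S] H2_bounded_opD[OF T])
qed

lemma H2_bounded_op_funpow:
  assumes "H2_bounded_op T"
  shows "H2_bounded_op (T ^^ n)"
proof (induction n)
  case 0
  show ?case
    using H2_bounded_op_id by (simp add: id_def)
next
  case (Suc n)
  show ?case
    using H2_bounded_op_compose[OF assms Suc] by (simp add: comp_def)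
qed

lemma H2_bounded_op_cmult:
  assumes T: "H2_bounded_op T"
  shows "H2_bounded_op (\<lambda>f z. c * T f z)"
proof -
  obtain K where K: "0 < K" "\<And>f. f \<in> H2 \<Longrightarrow> H2_norm (T f) \<le> K * H2_norm f"
    by (rule H2_bounded_op_bound[OF T]) blast
  show ?thesis
  proof (rule H2_bounded_opI[where K = "cmod c * K"])
    show "H2_norm (\<lambda>z. c * T f z) \<le> cmod c * K * H2_norm f" if "f \<in> H2" for f
      using mult_left_mono[OF K(2)[OF that], of "cmod c"]
      by (simp add: H2_cmult(3)[OF H2_bounded_opD(1)[OF T that]] mult.assoc)
  qed (simp_all add: H2_bounded_opD[OF T] H2_cmult(1) algebra_simps)
qed

lemma H2_bounded_op_add:
  assumes S: "H2_bounded_op S" and T: "H2_bounded_op T"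
  shows "H2_bounded_op (\<lambda>f z. S f z + T f z)"
proof -
  obtain K where K: "0 < K" "\<And>f. f \<in> H2 \<Longrightarrow> H2_norm (S f) \<le> K * H2_norm f"
    by (rule H2_bounded_op_bound[OF S]) blast
  obtain L where L: "0 < L" "\<And>f. f \<in> H2 \<Longrightarrow> H2_norm (T f) \<le> L * H2_norm f"
    by (rule H2_bounded_op_bound[OF T]) blast
  show ?thesis
  proof (rule H2_bounded_opI[where K = "K + L"])
    show "H2_norm (\<lambda>z. S f z + T f z) \<le> (K + L) * H2_norm f" if "f \<in> H2" for f
      using H2_add(3)[of "S f" "T f"] K(2)[OF that] L(2)[OF that]
        H2_bounded_opD(1)[OF S that] H2_bounded_opD(1)[OF T that]
      by (simp add: distrib_right)
  qed (simp_all add: H2_bounded_opD[OF S] H2_bounded_opD[OF T] H2_add(1) algebra_simps)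
qed

lemma H2_bounded_op_sum_ops:
  assumes "finite A" "\<And>i. i \<in> A \<Longrightarrow> H2_bounded_op (T i)"
  shows "H2_bounded_op (\<lambda>f z. \<Sum>i\<in>A. T i f z)"
  using assms
proof (induction A rule: finite_induct)
  case empty
  show ?case
    using H2_bounded_op_cmult[OF H2_bounded_op_id, of 0] by simp
next
  case (insert x A)
  then show ?case
    using H2_bounded_op_add[of "T x" "\<lambda>f z. \<Sum>i\<in>A. T i f z"] by simp
qed

text \<open>Continuity of \<open>T\<close> in the form needed for the Neumann series: the tail of
  the series has norm of order \<open>q ^ N\<close>, \<open>T\<close> enlarges it at most by
  \<open>K\<close>, and point evaluation at \<open>z\<close> is bounded.\<close>

lemma H2_bounded_op_sums:
  assumes T: "H2_bounded_op T"
    and F: "\<And>n. F n \<in> H2" and bd: "\<And>n. H2_norm (F n) \<le> M * q ^ n" and q: "0 \<le> q" "q < 1"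
    and g: "g \<in> H2" "\<And>z. z \<in> unit_disc \<Longrightarrow> (\<lambda>n. F n z) sums g z"
    and z: "z \<in> unit_disc"
  shows "(\<lambda>n. T (F n) z) sums T g z"
proof -
  obtain K where K: "0 < K" "\<And>f. f \<in> H2 \<Longrightarrow> H2_norm (T f) \<le> K * H2_norm f"
    by (rule H2_bounded_op_bound[OF T]) blast
  have s: "sqrt (1 - (cmod z)\<^sup>2) > 0"
    using z by (simp add: abs_square_less_1)
  define C where "C = K * (M / (1 - q)) / sqrt (1 - (cmod z)\<^sup>2)"
  have bound: "cmod (T g z - (\<Sum>n<N. T (F n) z)) \<le> C * q ^ N" for N
  proof -
    have "H2_norm (F (n + N)) \<le> M * q ^ N * q ^ n" for n
      using bd[of "n + N"] by (simp add: power_add mult_ac)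
    then obtain r where r: "r \<in> H2" "H2_norm r \<le> M * q ^ N / (1 - q)"
      and rs: "\<And>z. z \<in> unit_disc \<Longrightarrow> (\<lambda>n. F (n + N) z) sums r z"
      using H2_geometric_series[of "\<lambda>n. F (n + N)" "M * q ^ N" q] F q by metis
    have "g = (\<lambda>z. r z + (\<Sum>n<N. F n z))"
    proof (rule H2_eqI[OF g(1)])
      show "(\<lambda>z. r z + (\<Sum>n<N. F n z)) \<in> H2"
        by (intro H2_add(1) r(1) H2_sum(1) F)
      show "g w = r w + (\<Sum>n<N. F n w)" if "w \<in> unit_disc" for w
        using sums_unique2[OF rs[OF that], of "g w - (\<Sum>n<N. F n w)"]
          sums_split_initial_segment[OF g(2)[OF that], of N] by simp
    qed
    then have "T g = (\<lambda>z. T r z + (\<Sum>n<N. T (F n) z))"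
      using H2_bounded_opD(2)[OF T r(1) H2_sum(1)[of "{..<N}" F]] H2_bounded_op_sum[OF T, of "{..<N}" F] F
      by simp
    then have "cmod (T g z - (\<Sum>n<N. T (F n) z)) * sqrt (1 - (cmod z)\<^sup>2) \<le> H2_norm (T r)"
      using H2_pointwise_bound[OF H2_bounded_opD(1)[OF T r(1)] z] by simp
    also have "\<dots> \<le> K * (M * q ^ N / (1 - q))"
      using K(1) by (intro order_trans[OF K(2)[OF r(1)]] mult_left_mono r(2)) auto
    finally have "cmod (T g z - (\<Sum>n<N. T (F n) z))
        \<le> K * (M * q ^ N / (1 - q)) / sqrt (1 - (cmod z)\<^sup>2)"
      using s by (simp only: pos_le_divide_eq)
    then show ?thesis
      by (simp add: C_def mult_ac)
  qed
  have "(\<lambda>N. C * q ^ N) \<longlonglongrightarrow> C * 0"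
    using q by (intro tendsto_mult tendsto_const LIMSEQ_power_zero) auto
  then have "(\<lambda>N. T g z - (\<Sum>n<N. T (F n) z)) \<longlonglongrightarrow> 0"
    using Lim_null_comparison[OF always_eventually[OF allI[OF bound]]] by simp
  from tendsto_diff[OF tendsto_const[of "T g z"] this] show ?thesis
    by (simp add: sums_def)
qed

section \<open>Resolvents and the spectrum of a unitary operator\<close>

lemma H2_not_in_spectrumI:
  assumes "H2_bounded_op S"
    and "\<And>f. f \<in> H2 \<Longrightarrow> S (\<lambda>z. c * f z - T f z) = f"
    and "\<And>f. f \<in> H2 \<Longrightarrow> (\<lambda>z. c * S f z - T (S f) z) = f"
  shows "c \<notin> H2_spectrum T"
  using assms by (auto simp: H2_spectrum_def H2_inverse_ops_def)

lemma H2_not_in_spectrumE: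
  assumes "c \<notin> H2_spectrum T"
  obtains S where "H2_bounded_op S"
    "\<forall>f\<in>H2. S (\<lambda>z. c * f z - T f z) = f"
    "\<forall>f\<in>H2. (\<lambda>z. c * S f z - T (S f) z) = f"
  using assms by (auto simp: H2_spectrum_def H2_inverse_ops_def)

text \<open>The inverse of \<open>c - T\<close> is the Neumann series with terms
  \<open>T ^^ n / c ^ Suc n\<close>, dominated by a geometric series of ratio
  \<open>1 / cmod c\<close>.\<close>

lemma H2_contraction_resolvent:
  assumes T: "H2_bounded_op T" and contr: "\<And>f. f \<in> H2 \<Longrightarrow> H2_norm (T f) \<le> H2_norm f"
    and c: "1 < cmod c"
  shows "c \<notin> H2_spectrum T"
proof -
  have c0: "c \<noteq> 0"
    using c by auto
  define q where "q = 1 / cmod c"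
  have q: "0 \<le> q" "q < 1"
    using c by (auto simp: q_def divide_less_eq)
  define F where "F f n = (\<lambda>z. 1 / c ^ Suc n * (T ^^ n) f z)" for f n
  have FH: "F f n \<in> H2" if "f \<in> H2" for f n
    unfolding F_def by (intro H2_cmult(1) H2_bounded_opD(1)[OF H2_bounded_op_funpow[OF T]] that)
  have pow: "H2_norm ((T ^^ n) f) \<le> H2_norm f" if "f \<in> H2" for f n
  proof (induction n)
    case (Suc n)
    then show ?case
      using contr[OF H2_bounded_opD(1)[OF H2_bounded_op_funpow[OF T] that], of n] by simp
  qed simp
  have Fbd: "H2_norm (F f n) \<le> H2_norm f * q * q ^ n" if "f \<in> H2" for f n
    using mult_right_mono[OF pow[OF that, of n], of "q * q ^ n"] q
    unfolding F_def H2_cmult(3)[OF H2_bounded_opD(1)[OF H2_bounded_op_funpow[OF T] that]]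
    by (simp add: q_def norm_divide norm_power norm_mult power_divide mult_ac)
  define S where "S f z = (if z \<in> unit_disc then \<Sum>n. F f n z else 0)" for f z
  have S: "S f \<in> H2 \<and> H2_norm (S f) \<le> q / (1 - q) * H2_norm f
      \<and> (\<forall>z\<in>unit_disc. (\<lambda>n. F f n z) sums S f z)" if f: "f \<in> H2" for f
  proof -
    obtain g where g: "g \<in> H2" "H2_norm g \<le> H2_norm f * q / (1 - q)"
      and gs: "\<And>z. z \<in> unit_disc \<Longrightarrow> (\<lambda>n. F f n z) sums g z"
      using H2_geometric_series[OF FH[OF f] Fbd[OF f] q] by metis
    have "g z = S f z" for z
      using gs[of z] H2_outside[OF g(1), of z] by (auto simp: S_def sums_iff)
    then have "S f = g"
      by auto
    with g gs show ?thesis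
      by (simp add: mult.commute)
  qed
  have SH: "S f \<in> H2" and Sbd: "H2_norm (S f) \<le> q / (1 - q) * H2_norm f" if "f \<in> H2" for f
    using S[OF that] by auto
  have Ss: "(\<lambda>n. F f n z) sums S f z" if "f \<in> H2" "z \<in> unit_disc" for f z
    using S[OF that(1)] that(2) by auto
  have add: "S (\<lambda>z. f z + g z) = (\<lambda>z. S f z + S g z)" if f: "f \<in> H2" and g: "g \<in> H2" for f g
  proof (rule H2_eqI)
    show "S (\<lambda>z. f z + g z) \<in> H2"
      by (intro SH H2_add f g)
    show "(\<lambda>z. S f z + S g z) \<in> H2"
      by (intro SH H2_add f g)
    fix z assume z: "z \<in> unit_disc"
    have "(\<lambda>n. F f n z + F g n z) sums (S f z + S g z)"
      by (intro sums_add Ss f g z)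
    moreover have "F f n z + F g n z = F (\<lambda>z. f z + g z) n z" for n
      unfolding F_def H2_bounded_opD(2)[OF H2_bounded_op_funpow[OF T] f g] by (simp add: algebra_simps)
    ultimately show "S (\<lambda>z. f z + g z) z = S f z + S g z"
      using Ss[OF H2_add(1)[OF f g] z] by (simp add: sums_unique2)
  qed
  have cmult: "S (\<lambda>z. d * f z) = (\<lambda>z. d * S f z)" if f: "f \<in> H2" for d f
  proof (rule H2_eqI)
    show "S (\<lambda>z. d * f z) \<in> H2"
      by (intro SH H2_cmult f)
    show "(\<lambda>z. d * S f z) \<in> H2"
      by (intro SH H2_cmult f)
    fix z assume z: "z \<in> unit_disc"
    have "(\<lambda>n. d * F f n z) sums (d * S f z)"
      by (intro sums_mult Ss f z)
    moreover have "d * F f n z = F (\<lambda>z. d * f z) n z" for n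
      unfolding F_def H2_bounded_opD(3)[OF H2_bounded_op_funpow[OF T] f] by (simp add: algebra_simps)
    ultimately show "S (\<lambda>z. d * f z) z = d * S f z"
      using Ss[OF H2_cmult(1)[OF f] z, of d] by (simp add: sums_unique2)
  qed
  have Sop: "H2_bounded_op S"
    by (rule H2_bounded_opI[OF SH add cmult Sbd])
  \<comment> \<open>Dropping the first term \<open>f z / c\<close> and multiplying by
    \<open>c\<close> gives the series for both \<open>S (T f)\<close> and \<open>T (S f)\<close>, so
    one computation serves both sides of the inverse.\<close>
  have shift: "(\<lambda>n. c * F f (Suc n) z) sums (c * S f z - f z)" if "f \<in> H2" "z \<in> unit_disc" for f z
    using sums_mult[OF sums_split_initial_segment[OF Ss[OF that], of 1], of c] c0
    by (simp add: F_def right_diff_distrib)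
  have cS: "S (T f) = (\<lambda>z. c * S f z - f z)" if f: "f \<in> H2" for f
  proof (rule H2_eqI)
    show "S (T f) \<in> H2"
      by (intro SH H2_bounded_opD(1)[OF T] f)
    show "(\<lambda>z. c * S f z - f z) \<in> H2"
      by (intro SH H2_cmult(1) H2_diff f)
    fix z assume z: "z \<in> unit_disc"
    have "F (T f) n z = c * F f (Suc n) z" for n
      using c0 by (simp add: F_def funpow_swap1)
    then show "S (T f) z = c * S f z - f z"
      using sums_unique2[OF Ss[OF H2_bounded_opD(1)[OF T f] z]] shift[OF f z] by simp
  qed
  have cT: "T (S f) = (\<lambda>z. c * S f z - f z)" if f: "f \<in> H2" for f
  proof (rule H2_eqI)
    show "T (S f) \<in> H2"
      by (intro SH H2_bounded_opD(1)[OF T] f)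
    show "(\<lambda>z. c * S f z - f z) \<in> H2"
      by (intro SH H2_cmult(1) H2_diff f)
    fix z assume z: "z \<in> unit_disc"
    have "T (F f n) z = c * F f (Suc n) z" for n
      unfolding F_def H2_bounded_opD(3)[OF T H2_bounded_opD(1)[OF H2_bounded_op_funpow[OF T] f]]
      using c0 by simp
    then show "T (S f) z = c * S f z - f z"
      using sums_unique2[OF H2_bounded_op_sums[OF T FH[OF f] Fbd[OF f] q SH[OF f] Ss[OF f] z]]
        shift[OF f z] by simp
  qed
  show ?thesis
  proof (rule H2_not_in_spectrumI[OF Sop])
    fix f assume f: "f \<in> H2"
    show "S (\<lambda>z. c * f z - T f z) = f"
      unfolding H2_bounded_op_diff[OF Sop H2_cmult(1)[OF f] H2_bounded_opD(1)[OF T f]]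
        cmult[OF f] cS[OF f] by simp
    show "(\<lambda>z. c * S f z - T (S f) z) = f"
      unfolding cT[OF f] by simp
  qed
qed

lemma H2_unitaryE:
  assumes "H2_unitary T"
  obtains S where "H2_bounded_op T" "H2_bounded_op S"
    "\<And>f. f \<in> H2 \<Longrightarrow> S (T f) = f" "\<And>f. f \<in> H2 \<Longrightarrow> T (S f) = f"
    "\<And>f g. f \<in> H2 \<Longrightarrow> g \<in> H2 \<Longrightarrow> H2_inner (T f) g = H2_inner f (S g)"
    "\<And>f. f \<in> H2 \<Longrightarrow> H2_norm (T f) = H2_norm f" "\<And>f. f \<in> H2 \<Longrightarrow> H2_norm (S f) = H2_norm f"
proof -
  obtain S where T: "H2_bounded_op T" and S: "H2_bounded_op S"
    and adj: "\<And>f g. f \<in> H2 \<Longrightarrow> g \<in> H2 \<Longrightarrow> H2_inner (T f) g = H2_inner f (S g)"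
    and inv: "\<And>f. f \<in> H2 \<Longrightarrow> S (T f) = f" "\<And>f. f \<in> H2 \<Longrightarrow> T (S f) = f"
    using assms unfolding H2_unitary_def H2_adjoint_ops_def H2_inverse_ops_def by blast
  have iso: "H2_norm (T f) = H2_norm f" if "f \<in> H2" for f
    using adj[OF that H2_bounded_opD(1)[OF T that]] inv(1)[OF that] by (simp add: H2_norm_def)
  have "H2_norm (S f) = H2_norm f" if "f \<in> H2" for f
    using iso[OF H2_bounded_opD(1)[OF S that]] inv(2)[OF that] by simp
  with T S adj inv iso show thesis
    using that by blast
qed

text \<open>Both \<open>T\<close> and its inverse \<open>S\<close> are isometries, hence
  contractions. The first fact excludes \<open>cmod c > 1\<close>; the second excludes
  \<open>0 < cmod c < 1\<close> through the resolvent of \<open>S\<close> at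
  \<open>1 / c\<close>.\<close>

lemma H2_unitary_spectrum_subset:
  assumes "H2_unitary T"
  shows "H2_spectrum T \<subseteq> sphere 0 1"
proof
  fix c assume c: "c \<in> H2_spectrum T"
  obtain S where T: "H2_bounded_op T" and S: "H2_bounded_op S"
    and ST: "\<And>f. f \<in> H2 \<Longrightarrow> S (T f) = f" and TS: "\<And>f. f \<in> H2 \<Longrightarrow> T (S f) = f"
    and iso: "\<And>f. f \<in> H2 \<Longrightarrow> H2_norm (T f) = H2_norm f" "\<And>f. f \<in> H2 \<Longrightarrow> H2_norm (S f) = H2_norm f"
    by (rule H2_unitaryE[OF assms]) blast
  have "\<not> cmod c > 1"
    using H2_contraction_resolvent[OF T] iso c by fastforce
  moreover have False if "cmod c < 1"
  proof (cases "c = 0")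
    case True
    have "c \<notin> H2_spectrum T"
    proof (rule H2_not_in_spectrumI)
      show "H2_bounded_op (\<lambda>f z. - 1 * S f z)"
        by (rule H2_bounded_op_cmult[OF S])
      show "(\<lambda>z. - 1 * S (\<lambda>z. c * f z - T f z) z) = f" if "f \<in> H2" for f
        using True H2_bounded_opD(3)[OF S H2_bounded_opD(1)[OF T that], of "- 1"] ST[OF that] by simp
      show "(\<lambda>z. c * (- 1 * S f z) - T (\<lambda>z. - 1 * S f z) z) = f" if "f \<in> H2" for f
        using True H2_bounded_opD(3)[OF T H2_bounded_opD(1)[OF S that], of "- 1"] TS[OF that] by simp
    qed
    with c show False
      by simp
  next
    case False
    then have "1 < cmod (1 / c)"
      using that by (simp add: norm_divide)
    then have "1 / c \<notin> H2_spectrum S"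
      using H2_contraction_resolvent[OF S, of "1 / c"] iso by fastforce
    then obtain R where R: "H2_bounded_op R"
      and R1: "\<forall>f\<in>H2. R (\<lambda>z. 1 / c * f z - S f z) = f"
      and R2: "\<forall>f\<in>H2. (\<lambda>z. 1 / c * R f z - S (R f) z) = f"
      by (rule H2_not_in_spectrumE)
    have "c \<notin> H2_spectrum T"
    proof (rule H2_not_in_spectrumI)
      \<comment> \<open>Since \<open>T S\<close> is the identity, \<open>c - T\<close> factors as
        \<open>- c\<close> times \<open>T\<close> times \<open>1 / c - S\<close>; inverting the
        factors in reverse order gives this operator.\<close>
      show "H2_bounded_op (\<lambda>f z. - (1 / c) * R (S f) z)"
        by (rule H2_bounded_op_cmult[OF H2_bounded_op_compose[OF R S]])
      fix f assume f: "f \<in> H2"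
      note Tf = H2_bounded_opD(1)[OF T f] and Sf = H2_bounded_opD(1)[OF S f]
      have "S (\<lambda>z. c * f z - T f z) = (\<lambda>z. c * (S f z - 1 / c * f z))"
        using False
        unfolding H2_bounded_op_diff[OF S H2_cmult(1)[OF f] Tf] H2_bounded_opD(3)[OF S f] ST[OF f]
        by (intro ext) (simp add: field_simps)
      also have "\<dots> = (\<lambda>z. - c * (1 / c * f z - S f z))"
        by (simp add: algebra_simps)
      finally have "R (S (\<lambda>z. c * f z - T f z)) = (\<lambda>z. - c * f z)"
        using H2_bounded_opD(3)[OF R H2_diff[OF H2_cmult(1)[OF f] Sf], of "- c" "1 / c"] bspec[OF R1 f] by simp
      then show "(\<lambda>z. - (1 / c) * R (S (\<lambda>z. c * f z - T f z)) z) = f"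
        using False by simp
      note RSf = H2_bounded_opD(1)[OF R Sf]
      note SRSf = H2_bounded_opD(1)[OF S RSf]
      have "T (S f) = T (\<lambda>z. 1 / c * R (S f) z - S (R (S f)) z)"
        using bspec[OF R2 Sf] by simp
      also have "\<dots> = (\<lambda>z. 1 / c * T (R (S f)) z - R (S f) z)"
        unfolding H2_bounded_op_diff[OF T H2_cmult(1)[OF RSf] SRSf] H2_bounded_opD(3)[OF T RSf] TS[OF RSf] ..
      finally have *: "f z = 1 / c * T (R (S f)) z - R (S f) z" for z
        using TS[OF f] by metis
      show "(\<lambda>z. c * (- (1 / c) * R (S f) z) - T (\<lambda>z. - (1 / c) * R (S f) z) z) = f"
        unfolding H2_bounded_opD(3)[OF T RSf] using False
        by (auto simp: * algebra_simps)
    qed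
    with c show False
      by simp
  qed
  ultimately show "c \<in> sphere 0 1"
    by fastforce
qed

section \<open>The kernel identity\<close>

lemma norm_Moebius_less_1:
  assumes "z \<in> unit_disc" "b \<in> unit_disc"
  shows "cmod ((z - b) / (1 - cnj b * z)) < 1"
  using Moebius_function_norm_lt_1[of b z 0] assms by (simp add: Moebius_function_def)

text \<open>The equation says that \<open>W\<close> times its adjoint is the identity, tested on
  Szego kernels. The geometry of \<phi> and the size of \<psi> follow from it by algebra.\<close>

locale kernel_identity =
  fixes \<phi> \<psi> :: "complex \<Rightarrow> complex"
  assumes maps_to_disc: "z \<in> unit_disc \<Longrightarrow> \<phi> z \<in> unit_disc"
    and kernel_eq: "z \<in> unit_disc \<Longrightarrow> w \<in> unit_disc \<Longrightarrow>
      \<psi> z * cnj (\<psi> w) * (1 - z * cnj w) = 1 - \<phi> z * cnj (\<phi> w)"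
begin

lemma weight_norm:
  assumes "z \<in> unit_disc"
  shows "(cmod (\<psi> z))\<^sup>2 * (1 - (cmod z)\<^sup>2) = 1 - (cmod (\<phi> z))\<^sup>2"
proof -
  have "complex_of_real ((cmod (\<psi> z))\<^sup>2 * (1 - (cmod z)\<^sup>2)) = complex_of_real (1 - (cmod (\<phi> z))\<^sup>2)"
    using kernel_eq[OF assms assms] by (simp add: complex_norm_square del: of_real_power)
  then show ?thesis
    by (simp only: of_real_eq_iff)
qed

lemma weight_neq_0:
  assumes "z \<in> unit_disc"
  shows "\<psi> z \<noteq> 0"
proof -
  have "(cmod (\<phi> z))\<^sup>2 < 1"
    using maps_to_disc[OF assms] by (simp add: abs_square_less_1)
  then show ?thesis
    using weight_norm[OF assms] by auto
qed

text \<open>One minus such a product equals \<open>(1 - b * cnj b) * (1 - z * cnj w) / ((1 - z * cnj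
  b) * (1 - b * cnj w))\<close>. Passing to the images under \<phi> multiplies each of the four
  factors by weights, as the kernel identity shows, and in the quotient all weights cancel.\<close>

lemma Moebius_inner:
  assumes b: "b \<in> unit_disc" and z: "z \<in> unit_disc" and w: "w \<in> unit_disc"
  shows "(\<phi> z - \<phi> b) / (1 - cnj (\<phi> b) * \<phi> z) * cnj ((\<phi> w - \<phi> b) / (1 - cnj (\<phi> b) * \<phi> w))
    = (z - b) / (1 - cnj b * z) * cnj ((w - b) / (1 - cnj b * w))"
proof -
  have split: "(x - c) / (1 - cnj c * x) * cnj ((y - c) / (1 - cnj c * y))
      = 1 - (1 - c * cnj c) * (1 - x * cnj y) / ((1 - x * cnj c) * (1 - c * cnj y))"
    if "x \<in> unit_disc" "y \<in> unit_disc" "c \<in> unit_disc" for x y c :: complex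
  proof -
    have 1: "1 - cnj c * x \<noteq> 0" "1 - c * cnj y \<noteq> 0"
      using one_minus_mult_neq_0(1)[of x "cnj c"] one_minus_mult_neq_0(1)[of "cnj y" c] that by auto
    have "(x - c) * (cnj y - cnj c)
        = (1 - cnj c * x) * (1 - c * cnj y) - (1 - c * cnj c) * (1 - x * cnj y)"
      by (simp add: algebra_simps)
    then have "(x - c) * (cnj y - cnj c) / ((1 - cnj c * x) * (1 - c * cnj y))
        = 1 - (1 - c * cnj c) * (1 - x * cnj y) / ((1 - cnj c * x) * (1 - c * cnj y))"
      using 1 by (simp add: diff_divide_distrib)
    then show ?thesis
      by (simp add: mult.commute[of x])
  qed
  have ne: "\<psi> z \<noteq> 0" "\<psi> w \<noteq> 0" "\<psi> b \<noteq> 0"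
    using weight_neq_0 b z w by auto
  have "(1 - \<phi> b * cnj (\<phi> b)) * (1 - \<phi> z * cnj (\<phi> w))
      / ((1 - \<phi> z * cnj (\<phi> b)) * (1 - \<phi> b * cnj (\<phi> w)))
      = (1 - b * cnj b) * (1 - z * cnj w) / ((1 - z * cnj b) * (1 - b * cnj w))"
    unfolding kernel_eq[OF b b, symmetric] kernel_eq[OF z w, symmetric]
      kernel_eq[OF z b, symmetric] kernel_eq[OF b w, symmetric]
    using ne by simp
  then show ?thesis
    unfolding split[OF z w b] split[OF maps_to_disc[OF z] maps_to_disc[OF w] maps_to_disc[OF b]]
    by simp
qed

text \<open>Two functions with the same products \<open>t z * cnj (t y) = s z * cnj (s y)\<close>
  differ by a unimodular constant: fix \<open>y = w\<close> with \<open>s w \<noteq> 0\<close> and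
  solve for \<open>t z\<close>.\<close>

lemma Moebius_conj:
  assumes b: "b \<in> unit_disc"
  obtains l where "cmod l = 1" "\<And>z. z \<in> unit_disc \<Longrightarrow>
    (\<phi> z - \<phi> b) / (1 - cnj (\<phi> b) * \<phi> z) = l * ((z - b) / (1 - cnj b * z))"
proof -
  define s t where "s z = (z - b) / (1 - cnj b * z)"
    and "t z = (\<phi> z - \<phi> b) / (1 - cnj (\<phi> b) * \<phi> z)" for z
  obtain w where w: "w \<in> unit_disc" "w \<noteq> b"
    by (cases "b = 0") (auto intro: that[of 0] that[of "1/2"])
  have st: "t z * cnj (t y) = s z * cnj (s y)" if "z \<in> unit_disc" "y \<in> unit_disc" for z y
    unfolding s_def t_def by (rule Moebius_inner[OF b that])
  have sw: "s w \<noteq> 0"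
    using w b one_minus_mult_neq_0(1)[of w "cnj b"] by (simp add: s_def)
  have "complex_of_real ((cmod (t w))\<^sup>2) = complex_of_real ((cmod (s w))\<^sup>2)"
    using st[OF w(1) w(1)] by (simp add: complex_norm_square del: of_real_power)
  then have n: "cmod (t w) = cmod (s w)"
    by (simp only: of_real_eq_iff) simp
  then have tw: "t w \<noteq> 0"
    using sw by auto
  show thesis
  proof (rule that[of "t w / s w"])
    show "cmod (t w / s w) = 1"
      using n sw by (simp add: norm_divide)
    fix z assume z: "z \<in> unit_disc"
    have "t z * (t w * cnj (t w)) = s z * cnj (s w) * t w"
      using st[OF z w(1)] by (simp add: mult_ac)
    also have "t w * cnj (t w) = s w * cnj (s w)"
      by (rule st[OF w(1) w(1)])
    finally have "t z * s w * cnj (s w) = t w * s z * cnj (s w)"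
      by (simp add: mult_ac)
    then have "t z = t w / s w * s z"
      using sw by (simp add: field_simps)
    then show "(\<phi> z - \<phi> b) / (1 - cnj (\<phi> b) * \<phi> z) = t w / s w * ((z - b) / (1 - cnj b * z))"
      by (simp only: s_def t_def)
  qed
qed

text \<open>The case \<open>b = 0\<close> of the conjugation, solved for \<open>\<phi> z\<close>. It
  is kept multiplied out so that it can be passed to the limit along orbits tending to the
  circle.\<close>

lemma Moebius_form:
  obtains l where "cmod l = 1"
    "\<And>z. z \<in> unit_disc \<Longrightarrow> \<phi> z * (1 + cnj (\<phi> 0) * l * z) = l * z + \<phi> 0"
proof -
  obtain l where l: "cmod l = 1" and eq: "\<And>z. z \<in> unit_disc \<Longrightarrow>
      (\<phi> z - \<phi> 0) / (1 - cnj (\<phi> 0) * \<phi> z) = l * ((z - 0) / (1 - cnj 0 * z))"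
    using Moebius_conj[of 0] by auto
  show thesis
  proof (rule that[OF l])
    fix z assume z: "z \<in> unit_disc"
    have "1 - cnj (\<phi> 0) * \<phi> z \<noteq> 0"
      using one_minus_mult_neq_0(1)[OF maps_to_disc[OF z], of "cnj (\<phi> 0)"] maps_to_disc[of 0] by simp
    then show "\<phi> z * (1 + cnj (\<phi> 0) * l * z) = l * z + \<phi> 0"
      using eq[OF z] by (simp add: field_simps)
  qed
qed

lemma bij_disc: "bij_betw \<phi> unit_disc unit_disc"
proof -
  define a where "a = \<phi> 0"
  obtain l where l: "cmod l = 1"
    and eq: "\<And>z. z \<in> unit_disc \<Longrightarrow> \<phi> z * (1 + cnj a * l * z) = l * z + a"
    using Moebius_form unfolding a_def by blast
  have a: "a \<in> unit_disc"
    unfolding a_def by (rule maps_to_disc) simp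
  have l0: "l \<noteq> 0"
    using l by auto
  have a1: "1 - a * cnj a \<noteq> 0"
    using one_minus_mult_neq_0(1)[of "cnj a" a] a by simp
  \<comment> \<open>Obtained by solving \<open>eq\<close> for \<open>z\<close> in terms of the value
    \<open>u\<close>.\<close>
  define h where "h u = (u - a) / (1 - cnj a * u) / l" for u
  show ?thesis
  proof (rule bij_betw_byWitness[where f' = h])
    show "\<phi> ` unit_disc \<subseteq> unit_disc"
      using maps_to_disc by auto
    show chi: "h ` unit_disc \<subseteq> unit_disc"
      using norm_Moebius_less_1[OF _ a] l by (auto simp: h_def norm_divide norm_mult)
    show "\<forall>z\<in>unit_disc. h (\<phi> z) = z"
    proof
      fix z assume z: "z \<in> unit_disc"
      have "1 - cnj a * \<phi> z \<noteq> 0"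
        using one_minus_mult_neq_0(1)[OF maps_to_disc[OF z], of "cnj a"] a by simp
      then show "h (\<phi> z) = z"
        using eq[OF z] l0 by (simp add: h_def field_simps)
    qed
    show "\<forall>u\<in>unit_disc. \<phi> (h u) = u"
    proof
      fix u assume u: "u \<in> unit_disc"
      then have cu: "h u \<in> unit_disc"
        using chi by blast
      have ne: "1 - cnj a * u \<noteq> 0"
        using one_minus_mult_neq_0(1)[OF u, of "cnj a"] a by simp
      have lc: "l * h u * (1 - cnj a * u) = u - a"
        using ne l0 by (simp add: h_def)
      \<comment> \<open>The decomposition
        \<open>1 - a * cnj a = (1 - cnj a * u) + cnj a * (u - a)\<close>, with \<open>u - a\<close>
        rewritten by \<open>lc\<close>, produces the denominator occurring in
        \<open>eq\<close>.\<close>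
      have "\<phi> (h u) * (1 - a * cnj a) = \<phi> (h u) * ((1 - cnj a * u) + cnj a * (l * h u * (1 - cnj a * u)))"
        unfolding lc by (simp add: algebra_simps)
      also have "\<dots> = (\<phi> (h u) * (1 + cnj a * l * h u)) * (1 - cnj a * u)"
        by (simp add: algebra_simps)
      also have "\<dots> = l * h u * (1 - cnj a * u) + a * (1 - cnj a * u)"
        unfolding eq[OF cu] by (simp add: algebra_simps)
      also have "\<dots> = u * (1 - a * cnj a)"
        unfolding lc by (simp add: algebra_simps)
      finally show "\<phi> (h u) = u"
        using a1 by simp
    qed
  qed
qed

end

lemma unitary_kernel_identity:
  assumes maps: "\<phi> ` unit_disc \<subseteq> unit_disc" and W: "H2_unitary (weighted_comp \<psi> \<phi>)"
  shows "kernel_identity \<phi> \<psi>"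
proof
  show maps': "\<phi> z \<in> unit_disc" if "z \<in> unit_disc" for z
    using maps that by blast
  let ?W = "weighted_comp \<psi> \<phi>"
  obtain S where S: "H2_bounded_op S" and TS: "\<And>f. f \<in> H2 \<Longrightarrow> ?W (S f) = f"
    and adj: "\<And>f g. f \<in> H2 \<Longrightarrow> g \<in> H2 \<Longrightarrow> H2_inner (?W f) g = H2_inner f (S g)"
    and op: "H2_bounded_op ?W"
    by (rule H2_unitaryE[OF W]) blast
  fix z w assume z: "z \<in> unit_disc" and w: "w \<in> unit_disc"
  note Kw = szego_kernel_H2(1)[OF w]
  \<comment> \<open>The adjoint sends the kernel at \<open>w\<close> to
    \<open>cnj (\<psi> w)\<close> times the kernel at \<open>\<phi> w\<close>; the latter is written
    here through the symmetry of the kernel under exchange of arguments and conjugation.\<close>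
  have SK: "S (szego_kernel w) u = cnj (\<psi> w) * cnj (szego_kernel u (\<phi> w))" if u: "u \<in> unit_disc" for u
  proof -
    note Ku = szego_kernel_H2(1)[OF u]
    have "cnj (S (szego_kernel w) u) = H2_inner (?W (szego_kernel u)) (szego_kernel w)"
      unfolding adj[OF Ku Kw]
      by (rule H2_inner_szego_kernel(2)[OF H2_bounded_opD(1)[OF S Kw] u, symmetric])
    also have "\<dots> = \<psi> w * szego_kernel u (\<phi> w)"
      unfolding H2_inner_szego_kernel(1)[OF H2_bounded_opD(1)[OF op Ku] w]
      using w by (simp add: weighted_comp_def)
    finally show ?thesis
      by (metis complex_cnj_cnj complex_cnj_mult)
  qed
  have "szego_kernel w z = ?W (S (szego_kernel w)) z"
    by (simp only: TS[OF Kw])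
  also have "\<dots> = \<psi> z * (cnj (\<psi> w) * cnj (szego_kernel (\<phi> z) (\<phi> w)))"
    using z SK[OF maps'[OF z]] by (simp add: weighted_comp_def)
  finally have "1 / (1 - cnj w * z) = \<psi> z * cnj (\<psi> w) / (1 - \<phi> z * cnj (\<phi> w))"
    using z w maps'[OF w] by (simp add: szego_kernel_def)
  moreover have "1 - cnj w * z \<noteq> 0" "1 - \<phi> z * cnj (\<phi> w) \<noteq> 0"
    using one_minus_mult_neq_0(1)[OF z, of "cnj w"] w
      one_minus_mult_neq_0(1)[of "cnj (\<phi> w)" "\<phi> z"] maps'[OF z] maps'[OF w] by auto
  ultimately show "\<psi> z * cnj (\<psi> w) * (1 - z * cnj w) = 1 - \<phi> z * cnj (\<phi> w)"
    by (simp add: field_simps)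
qed

section \<open>Elliptic automorphisms\<close>

text \<open>If \<open>S\<close> inverts \<open>c - T\<close> with bound \<open>K\<close>, then
  applying \<open>S\<close> to \<open>(c - l n) e n\<close> returns \<open>e n\<close>, so
  \<open>1 \<le> K * cmod (c - l n)\<close>. This fails once \<open>l n\<close> is within
  \<open>1 / K\<close> of \<open>c\<close>.\<close>

lemma eigenvalues_closure_subset_spectrum:
  assumes e: "\<And>n::nat. e n \<in> H2" "\<And>n. 0 < H2_norm (e n)"
    and eigen: "\<And>n. T (e n) = (\<lambda>z. l n * e n z)"
  shows "closure (range l) \<subseteq> H2_spectrum T"
proof
  fix c assume c: "c \<in> closure (range l)"
  show "c \<in> H2_spectrum T"
  proof (rule ccontr)
    assume "c \<notin> H2_spectrum T"
    then obtain S where S: "H2_bounded_op S" and inv: "\<forall>f\<in>H2. S (\<lambda>z. c * f z - T f z) = f"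
      by (rule H2_not_in_spectrumE)
    obtain K where K: "0 < K" "\<And>f. f \<in> H2 \<Longrightarrow> H2_norm (S f) \<le> K * H2_norm f"
      by (rule H2_bounded_op_bound[OF S]) blast
    obtain n where n: "dist (l n) c < 1 / K"
      using c K(1) unfolding closure_approachable by (metis imageE zero_less_divide_1_iff)
    have "e n = S (\<lambda>z. (c - l n) * e n z)"
      using bspec[OF inv e(1)[of n]] by (simp add: eigen left_diff_distrib)
    then have "H2_norm (e n) \<le> K * (cmod (c - l n) * H2_norm (e n))"
      using K(2)[OF H2_cmult(1)[OF e(1)[of n]], of "c - l n"] by (simp add: H2_cmult(3)[OF e(1)])
    also have "K * (cmod (c - l n) * H2_norm (e n)) < 1 * H2_norm (e n)"
      unfolding mult.assoc[symmetric]
      using n K(1) by (intro mult_strict_right_mono e(2))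
        (simp add: dist_norm norm_minus_commute field_simps)
    finally show False
      by simp
  qed
qed

text \<open>The inverse is read off from \<open>c ^ N - T ^ N = (c - T) (\<Sum>k<N. c ^ (N - 1 - k) T ^ k)\<close>.\<close>
lemma not_in_spectrum_if_power_scalar:
  assumes T: "H2_bounded_op T" and pow: "\<And>f. f \<in> H2 \<Longrightarrow> (T ^^ N) f = (\<lambda>z. b * f z)"
    and c: "c ^ N \<noteq> b"
  shows "c \<notin> H2_spectrum T"
proof -
  define d where "d k = c ^ (N - 1 - k) / (c ^ N - b)" for k
  define S where "S f = (\<lambda>z. \<Sum>k<N. d k * (T ^^ k) f z)" for f
  have Sop: "H2_bounded_op S"
    unfolding S_def
    by (rule H2_bounded_op_sum_ops) (simp_all add: H2_bounded_op_cmult[OF H2_bounded_op_funpow[OF T]])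
  have Tk: "(T ^^ k) f \<in> H2" if "f \<in> H2" for k f
    by (rule H2_bounded_opD(1)[OF H2_bounded_op_funpow[OF T] that])
  have TS: "T (S f) = (\<lambda>z. \<Sum>k<N. d k * (T ^^ Suc k) f z)" if f: "f \<in> H2" for f
  proof -
    have "T (S f) = (\<lambda>z. \<Sum>k<N. T (\<lambda>z. d k * (T ^^ k) f z) z)"
      unfolding S_def by (rule H2_bounded_op_sum[OF T]) (rule H2_cmult(1)[OF Tk[OF f]])
    moreover have "T (\<lambda>z. d k * (T ^^ k) f z) = (\<lambda>z. d k * (T ^^ Suc k) f z)" for k
      using H2_bounded_opD(3)[OF T Tk[OF f, of k], of "d k"] by (simp only: funpow.simps comp_apply)
    ultimately show ?thesis
      by (simp only:)
  qed
  have ST: "S (T f) = T (S f)" if f: "f \<in> H2" for f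
  proof -
    have Suc_right: "(T ^^ Suc k) f = (T ^^ k) (T f)" for k
      by (simp add: funpow_swap1)
    show ?thesis
      unfolding TS[OF f] Suc_right by (rule S_def)
  qed
  have inv: "(\<lambda>z. c * S f z - T (S f) z) = f" if f: "f \<in> H2" for f
  proof
    fix z
    \<comment> \<open>Applying \<open>c - T\<close> to the \<open>k\<close>-th summand of
      \<open>S f\<close> gives \<open>a k - a (Suc k)\<close>, so the sum collapses to its end
      terms, where \<open>T ^^ N\<close> acts as \<open>b\<close>.\<close>
    define a where "a k = c ^ (N - k) / (c ^ N - b) * (T ^^ k) f z" for k
    have "c * (d k * (T ^^ k) f z) - d k * (T ^^ Suc k) f z = a k - a (Suc k)" if k: "k < N" for k
    proof -
      obtain j where "N - k = Suc j" "N - Suc k = j" "N - 1 - k = j"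
        using k by (metis Suc_diff_Suc diff_Suc_eq_diff_pred)
      then show ?thesis
        by (simp add: a_def d_def)
    qed
    then have "c * S f z - T (S f) z = (\<Sum>k<N. a k - a (Suc k))"
      unfolding TS[OF f] by (simp add: S_def sum_distrib_left flip: sum_subtractf)
    also have "\<dots> = a 0 - a N"
      by (rule sum_lessThan_telescope')
    also have "\<dots> = (c ^ N - b) * f z / (c ^ N - b)"
      by (simp add: a_def pow[OF f] diff_divide_distrib left_diff_distrib)
    also have "\<dots> = f z"
      using c by simp
    finally show "c * S f z - T (S f) z = f z" .
  qed
  show ?thesis
  proof (rule H2_not_in_spectrumI[OF Sop])
    fix f assume f: "f \<in> H2"
    show "S (\<lambda>z. c * f z - T f z) = f"
      unfolding H2_bounded_op_diff[OF Sop H2_cmult(1)[OF f] H2_bounded_opD(1)[OF T f]]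
        H2_bounded_opD(3)[OF Sop f] ST[OF f] by (rule inv[OF f])
  qed (rule inv)
qed

text \<open>Kronecker's theorem: the argument of \<open>m\<close> divided by \<open>2 * pi\<close>
  is irrational, so the fractional parts of its multiples are dense in the unit interval. The
  continuous map \<open>x \<mapsto> b * cis (2 * pi * x)\<close> carries this density to the
  circle.\<close>

lemma circle_powers_dense:
  assumes m: "cmod m = 1" "\<And>N. N > 0 \<Longrightarrow> m ^ N \<noteq> 1" and b: "cmod b = 1"
  shows "sphere 0 1 \<subseteq> closure (range (\<lambda>n::nat. b * m ^ n))"
proof
  fix v :: complex
  assume v: "v \<in> sphere 0 1"
  have cis_Arg_unit: "cis (Arg w) = w" if "cmod w = 1" for w
  proof -
    have "w \<noteq> 0"
      using that by auto
    then have "cis (Arg w) = sgn w"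
      by (rule cis_Arg)
    then show ?thesis
      by (simp add: sgn_div_norm that)
  qed
  define \<theta> where "\<theta> = Arg m / (2 * pi)"
  have m_cis: "m = cis (2 * pi * \<theta>)"
    by (simp add: \<theta>_def cis_Arg_unit[OF m(1)])
  have cis_frac: "cis (2 * pi * frac x) = cis (2 * pi * x)" for x
  proof -
    have "cis (2 * pi * frac x) = cis (2 * pi * x) / cis (2 * pi * real_of_int \<lfloor>x\<rfloor>)"
      unfolding cis_divide frac_def right_diff_distrib ..
    then show ?thesis
      using cis_multiple_2pi[of "real_of_int \<lfloor>x\<rfloor>"] by simp
  qed
  have "\<theta> \<notin> \<rat>"
  proof
    assume "\<theta> \<in> \<rat>"
    then obtain i :: int and k :: nat where ik: "k \<noteq> 0" "\<theta> = real_of_int i / real k"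
      unfolding Rats_eq_int_div_nat by blast
    have "real k * (2 * pi * \<theta>) = 2 * pi * real_of_int i"
      using ik by simp
    then have "m ^ k = cis (2 * pi * real_of_int i)"
      unfolding m_cis Complex.DeMoivre by (simp only:)
    then show False
      using m(2)[of k] ik(1) cis_multiple_2pi[of "real_of_int i"] by simp
  qed
  then have dense: "closure (range (\<lambda>n. frac (real n * \<theta>))) = {0..1}"
    by (rule Kronecker_approx_1)
  define g where "g x = b * cis (2 * pi * x)" for x
  have "continuous_on (closure (range (\<lambda>n. frac (real n * \<theta>)))) g"
    unfolding g_def by (intro continuous_intros)
  then have sub: "g ` closure (range (\<lambda>n. frac (real n * \<theta>))) \<subseteq> closure (g ` range (\<lambda>n. frac (real n * \<theta>)))"
    by (rule image_closure_subset[OF _ closed_closure closure_subset])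
  have range_eq: "g ` range (\<lambda>n. frac (real n * \<theta>)) = range (\<lambda>n::nat. b * m ^ n)"
  proof -
    have "g (frac (real n * \<theta>)) = b * m ^ n" for n
      unfolding g_def cis_frac unfolding m_cis Complex.DeMoivre by (simp add: mult_ac)
    then show ?thesis
      by (simp add: image_image)
  qed
  define x where "x = frac (Arg (v / b) / (2 * pi))"
  have "x \<in> {0..1}"
    using frac_lt_1[of "Arg (v / b) / (2 * pi)"] by (simp add: x_def less_imp_le)
  then have "g x \<in> closure (range (\<lambda>n::nat. b * m ^ n))"
    using sub unfolding dense range_eq by blast
  moreover have "g x = v"
  proof -
    have "cis (Arg (v / b)) = v / b"
      by (rule cis_Arg_unit) (use v b in \<open>simp add: norm_divide\<close>)
    then have "g x = b * (v / b)"
      unfolding g_def x_def cis_frac by simp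
    then show ?thesis
      using b by auto
  qed
  ultimately show "v \<in> closure (range (\<lambda>n::nat. b * m ^ n))"
    by simp
qed

text \<open>By counting: minimality of \<open>N\<close> makes the first \<open>N\<close> powers of
  \<open>m\<close> distinct, and there are exactly \<open>N\<close> roots of unity of this
  order.\<close>

lemma root_of_unity_eq_power:
  fixes m z :: complex
  assumes m: "m ^ N = 1" and least: "\<And>k. 0 < k \<Longrightarrow> k < N \<Longrightarrow> m ^ k \<noteq> 1" and N: "N > 0"
    and z: "z ^ N = 1"
  shows "\<exists>k. z = m ^ k"
proof -
  have m0: "m \<noteq> 0"
    using m N by (auto simp: power_0_left)
  have inj: "inj_on (\<lambda>k. m ^ k) {..<N}"
  proof (rule linorder_inj_onI)
    fix i j assume ij: "i < j" "i \<in> {..<N}" "j \<in> {..<N}"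
    then have "m ^ j = m ^ i * m ^ (j - i)"
      by (simp flip: power_add)
    with ij least[of "j - i"] m0 show "m ^ i \<noteq> m ^ j"
      by auto
  qed auto
  have fin: "finite {z::complex. z ^ N = 1}"
    using N by (intro finite_roots_unity) simp
  have pow: "(m ^ k) ^ N = 1" for k
  proof -
    have "(m ^ k) ^ N = (m ^ N) ^ k"
      unfolding power_mult[symmetric] by (simp only: mult.commute)
    then show ?thesis
      by (simp add: m)
  qed
  have "(\<lambda>k. m ^ k) ` {..<N} = {z. z ^ N = 1}"
  proof (rule card_subset_eq[OF fin])
    show "(\<lambda>k. m ^ k) ` {..<N} \<subseteq> {z. z ^ N = 1}"
      using pow by blast
    show "card ((\<lambda>k. m ^ k) ` {..<N}) = card {z::complex. z ^ N = 1}"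
      using N by (simp add: card_image[OF inj] card_roots_unity_eq)
  qed
  then show ?thesis
    using z by blast
qed

context kernel_identity
begin

text \<open>The kernel identity with both arguments at \<open>p\<close> gives the modulus; with
  second argument \<open>p\<close> it determines \<psi>, after \<open>cnj (\<psi> p)\<close> is
  cancelled against \<open>\<psi> p\<close>.\<close>

lemma fixpoint_weight:
  assumes p: "p \<in> unit_disc" "\<phi> p = p"
  shows "cmod (\<psi> p) = 1"
    and "z \<in> unit_disc \<Longrightarrow> (1 - cnj p * z) * \<psi> z = \<psi> p * (1 - cnj p * \<phi> z)"
proof -
  have "(cmod p)\<^sup>2 < 1"
    using p by (simp add: abs_square_less_1)
  then have "(cmod (\<psi> p))\<^sup>2 = 1"
    using weight_norm[OF p(1)] p(2) by simp
  then show n: "cmod (\<psi> p) = 1"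
    by (simp add: power2_eq_1_iff) (use norm_ge_zero[of "\<psi> p"] in linarith)
  have u: "\<psi> p * cnj (\<psi> p) = 1"
    using n complex_norm_square[of "\<psi> p"] by simp
  assume z: "z \<in> unit_disc"
  have "\<psi> p * (1 - cnj p * \<phi> z) = (\<psi> p * cnj (\<psi> p)) * (\<psi> z * (1 - cnj p * z))"
    using kernel_eq[OF z p(1)] p(2) by (simp add: mult_ac)
  then show "(1 - cnj p * z) * \<psi> z = \<psi> p * (1 - cnj p * \<phi> z)"
    by (simp add: u)
qed

text \<open>In the coordinate that moves \<open>p\<close> to 0, \<phi> is a rotation by a unimodular
  \<open>l\<close>. Differentiating the multiplied-out relation at \<open>p\<close> identifies
  \<open>l\<close> with the derivative.\<close>

lemma fixpoint_deriv:
  assumes hol: "\<phi> holomorphic_on unit_disc" and p: "p \<in> unit_disc" "\<phi> p = p"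
  shows "cmod (deriv \<phi> p) = 1"
    and "z \<in> unit_disc \<Longrightarrow>
      (\<phi> z - p) / (1 - cnj p * \<phi> z) = deriv \<phi> p * ((z - p) / (1 - cnj p * z))"
proof -
  obtain l where l: "cmod l = 1" and eq: "\<And>z. z \<in> unit_disc \<Longrightarrow>
      (\<phi> z - p) / (1 - cnj p * \<phi> z) = l * ((z - p) / (1 - cnj p * z))"
    using Moebius_conj[OF p(1)] p(2) by metis
  have ne: "1 - cnj p * z \<noteq> 0" if "z \<in> unit_disc" for z
    using one_minus_mult_neq_0(1)[OF that, of "cnj p"] p(1) by simp
  have eq': "(\<phi> z - p) * (1 - cnj p * z) = l * (z - p) * (1 - cnj p * \<phi> z)" if z: "z \<in> unit_disc" for z
    using eq[OF z] ne[OF z] ne[OF maps_to_disc[OF z]] by (simp add: field_simps)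
  have d: "(\<phi> has_field_derivative deriv \<phi> p) (at p)"
    by (rule holomorphic_derivI[OF hol _ p(1)]) simp
  have "((\<lambda>z. l * (z - p) * (1 - cnj p * \<phi> z)) has_field_derivative l * (1 - cnj p * p)) (at p)"
    using p(2) by (auto intro!: derivative_eq_intros d)
  moreover have "((\<lambda>z. (\<phi> z - p) * (1 - cnj p * z)) has_field_derivative deriv \<phi> p * (1 - cnj p * p)) (at p)"
    using p(2) by (auto intro!: derivative_eq_intros d)
  then have "((\<lambda>z. l * (z - p) * (1 - cnj p * \<phi> z)) has_field_derivative deriv \<phi> p * (1 - cnj p * p)) (at p)"
    by (rule has_field_derivative_transform_within_open[where S = unit_disc]) (use p eq' in auto)
  ultimately have "deriv \<phi> p = l"
    using DERIV_unique ne[OF p(1)] by fastforce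
  with l eq show "cmod (deriv \<phi> p) = 1"
    and "z \<in> unit_disc \<Longrightarrow>
      (\<phi> z - p) / (1 - cnj p * \<phi> z) = deriv \<phi> p * ((z - p) / (1 - cnj p * z))"
    by auto
qed

lemma funpow_in_disc: "z \<in> unit_disc \<Longrightarrow> (\<phi> ^^ n) z \<in> unit_disc"
  by (induction n) (use maps_to_disc in auto)

text \<open>Multiplication by \<open>1 - cnj p * z\<close> turns \<open>W\<close> into
  \<open>\<psi> p\<close> times the unweighted composition with \<phi>, whose powers are
  immediate.\<close>

lemma fixpoint_weighted_comp_funpow:
  assumes p: "p \<in> unit_disc" "\<phi> p = p" and z: "z \<in> unit_disc"
  shows "(1 - cnj p * z) * (weighted_comp \<psi> \<phi> ^^ n) f z
    = \<psi> p ^ n * (1 - cnj p * (\<phi> ^^ n) z) * f ((\<phi> ^^ n) z)"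
  using z
proof (induction n arbitrary: z)
  case (Suc n)
  have "(1 - cnj p * z) * (weighted_comp \<psi> \<phi> ^^ Suc n) f z
      = ((1 - cnj p * z) * \<psi> z) * (weighted_comp \<psi> \<phi> ^^ n) f (\<phi> z)"
    using Suc.prems by (simp add: weighted_comp_def)
  also have "\<dots> = \<psi> p * ((1 - cnj p * \<phi> z) * (weighted_comp \<psi> \<phi> ^^ n) f (\<phi> z))"
    unfolding fixpoint_weight(2)[OF p Suc.prems] by (rule mult.assoc)
  also have "\<dots> = \<psi> p ^ Suc n * (1 - cnj p * (\<phi> ^^ Suc n) z) * f ((\<phi> ^^ Suc n) z)"
    unfolding Suc.IH[OF maps_to_disc[OF Suc.prems]] by (simp add: funpow_swap1 mult_ac)
  finally show ?case .
qed simp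

lemma elliptic_spectrum:
  assumes hol: "\<phi> holomorphic_on unit_disc" and W: "H2_unitary (weighted_comp \<psi> \<phi>)"
    and p: "p \<in> unit_disc" "\<phi> p = p"
  shows "H2_spectrum (weighted_comp \<psi> \<phi>) = closure (range (\<lambda>n::nat. \<psi> p * deriv \<phi> p ^ n))"
proof
  let ?W = "weighted_comp \<psi> \<phi>"
  define m where "m = deriv \<phi> p"
  define s where "s z = (z - p) / (1 - cnj p * z)" for z
  have m: "cmod m = 1" and sm: "\<And>z. z \<in> unit_disc \<Longrightarrow> s (\<phi> z) = m * s z"
    using fixpoint_deriv[OF hol p] by (auto simp: m_def s_def)
  note bp = fixpoint_weight(1)[OF p]
  have ne: "1 - cnj p * z \<noteq> 0" if "z \<in> unit_disc" for z
    using one_minus_mult_neq_0(1)[OF that, of "cnj p"] p(1) by simp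
  \<comment> \<open>A radius with \<open>1 < r\<close> and \<open>cmod p * r < 1\<close>, so that
    the eigenfunctions extend holomorphically past the closed disc.\<close>
  define r where "r = 2 / (1 + cmod p)"
  have p0: "0 < 1 + cmod p"
    using norm_ge_zero[of p] by linarith
  have r: "1 < r"
    using p p0 by (simp add: r_def field_simps)
  have ne': "1 - cnj p * z \<noteq> 0" if "z \<in> ball 0 r" for z
  proof
    assume "1 - cnj p * z = 0"
    then have "cmod (cnj p * z) = 1"
      by simp
    moreover have "cmod (cnj p * z) \<le> cmod p * r"
      unfolding norm_mult using that by (intro mult_mono) auto
    moreover have "cmod p * r < 1"
      using p p0 by (simp add: r_def field_simps)
    ultimately show False
      by simp
  qed
  define e where "e n z = (if z \<in> unit_disc then s z ^ n / (1 - cnj p * z) else 0)" for n z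
  have eH: "e n \<in> H2" for n
    unfolding e_def s_def
    by (rule H2_restrict[OF _ r]) (intro holomorphic_intros ne')
  \<comment> \<open>The zeros of the eigenfunctions lie only at \<open>p\<close>, so any other point
    certifies that all of them are nonzero.\<close>
  obtain w where w: "w \<in> unit_disc" "w \<noteq> p"
    by (cases "p = 0") (auto intro: that[of 0] that[of "1/2"])
  have epos: "0 < H2_norm (e n)" for n
    using ne[OF w(1)] w by (intro H2_norm_pos[OF eH w(1)]) (simp add: e_def s_def)
  have eigen: "?W (e n) = (\<lambda>z. (\<psi> p * m ^ n) * e n z)" for n
  proof
    fix z
    show "?W (e n) z = \<psi> p * m ^ n * e n z"
    proof (cases "z \<in> unit_disc")
      case True
      have "?W (e n) z = \<psi> z * (s (\<phi> z) ^ n / (1 - cnj p * \<phi> z))"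
        using True maps_to_disc[OF True] by (simp add: weighted_comp_def e_def)
      also have "\<dots> = \<psi> z / (1 - cnj p * \<phi> z) * s (\<phi> z) ^ n"
        by simp
      also have "\<psi> z / (1 - cnj p * \<phi> z) = \<psi> p / (1 - cnj p * z)"
        using fixpoint_weight(2)[OF p True] ne[OF True] ne[OF maps_to_disc[OF True]]
        by (simp add: frac_eq_eq mult.commute)
      also have "\<psi> p / (1 - cnj p * z) * s (\<phi> z) ^ n = \<psi> p * m ^ n * e n z"
        using True by (simp add: sm[OF True] e_def power_mult_distrib)
      finally show ?thesis .
    qed (simp add: weighted_comp_def e_def)
  qed
  show "closure (range (\<lambda>n::nat. \<psi> p * deriv \<phi> p ^ n)) \<subseteq> H2_spectrum ?W"
    using eigenvalues_closure_subset_spectrum[where e = e and l = "\<lambda>n. \<psi> p * m ^ n", OF eH epos eigen]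
    by (simp add: m_def)
  show "H2_spectrum ?W \<subseteq> closure (range (\<lambda>n::nat. \<psi> p * deriv \<phi> p ^ n))"
    unfolding m_def[symmetric]
  proof
    fix c assume c: "c \<in> H2_spectrum ?W"
    then have c1: "c \<in> sphere 0 1"
      using H2_unitary_spectrum_subset[OF W] by blast
    show "c \<in> closure (range (\<lambda>n::nat. \<psi> p * m ^ n))"
    proof (cases "\<exists>N>0. m ^ N = 1")
      case False
      then have "sphere 0 1 \<subseteq> closure (range (\<lambda>n::nat. \<psi> p * m ^ n))"
        by (intro circle_powers_dense[OF m _ bp]) blast
      then show ?thesis
        using c1 by (rule subsetD)
    next
      case True
      define N where "N = (LEAST N. 0 < N \<and> m ^ N = 1)"
      have N: "0 < N" "m ^ N = 1"
        using LeastI_ex[OF True] unfolding N_def by blast+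
      have least: "m ^ k \<noteq> 1" if "0 < k" "k < N" for k
        using not_less_Least[of k "\<lambda>N. 0 < N \<and> m ^ N = 1"] that unfolding N_def by blast
      have op: "H2_bounded_op ?W"
        using W by (simp add: H2_unitary_def)
      have pow: "(?W ^^ N) f = (\<lambda>z. \<psi> p ^ N * f z)" if f: "f \<in> H2" for f
      proof (rule H2_eqI)
        show "(?W ^^ N) f \<in> H2"
          by (rule H2_bounded_opD(1)[OF H2_bounded_op_funpow[OF op] f])
        show "(\<lambda>z. \<psi> p ^ N * f z) \<in> H2"
          by (rule H2_cmult(1)[OF f])
        fix z assume z: "z \<in> unit_disc"
        have sk: "s ((\<phi> ^^ k) z) = m ^ k * s z" for k
          by (induction k) (simp_all add: sm[OF funpow_in_disc[OF z]])
        have "s ((\<phi> ^^ N) z) = s z"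
          by (simp add: sk N)
        \<comment> \<open>Injectivity of the coordinate \<open>s\<close> on the disc, by
          cross-multiplying \<open>s ((\<phi> ^^ N) z) = s z\<close>.\<close>
        then have "((\<phi> ^^ N) z - z) * (1 - p * cnj p) = 0"
          using ne[OF z] ne[OF funpow_in_disc[OF z], of N] by (simp add: s_def field_simps)
        then have "(\<phi> ^^ N) z = z"
          using ne[OF p(1)] by (simp add: mult.commute)
        then show "(?W ^^ N) f z = \<psi> p ^ N * f z"
          using fixpoint_weighted_comp_funpow[OF p z, of N f] ne[OF z] by simp
      qed
      then have "c ^ N = \<psi> p ^ N"
        using not_in_spectrum_if_power_scalar[where b = "\<psi> p ^ N" and c = c, OF op pow] c by metis
      moreover have b0: "\<psi> p \<noteq> 0"
        using bp by auto
      ultimately have "(c / \<psi> p) ^ N = 1"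
        by (simp add: power_divide)
      then obtain k where "c / \<psi> p = m ^ k"
        using root_of_unity_eq_power[OF N(2) least N(1)] by blast
      then have "c = \<psi> p * m ^ k"
        using b0 by (simp add: field_simps)
      then show ?thesis
        using closure_subset[of "range (\<lambda>n::nat. \<psi> p * m ^ n)"] by auto
    qed
  qed
qed

end

section \<open>Automorphisms with a boundary fixed point\<close>

lemma two_sided_orbit:
  assumes f: "bij_betw f A A" and x: "x \<in> A"
  obtains u :: "int \<Rightarrow> 'a" where "u 0 = x" "\<forall>j. u j \<in> A" "\<forall>j. u (j + 1) = f (u j)"
proof -
  define h where "h = inv_into A f"
  define u where "u j = (if j \<ge> 0 then (f ^^ nat j) x else (h ^^ nat (- j)) x)" for j
  have fA: "f y \<in> A" and hA: "h y \<in> A" and fh: "f (h y) = y" if "y \<in> A" for y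
    using f that by (auto simp: h_def bij_betw_def inv_into_into f_inv_into_f)
  have fn: "(f ^^ n) x \<in> A" and hn: "(h ^^ n) x \<in> A" for n
    by (induction n) (auto simp: fA hA x)
  show thesis
  proof (rule that)
    show "u 0 = x"
      by (simp add: u_def)
    show "\<forall>j. u j \<in> A"
      by (simp add: u_def fn hn)
    show "\<forall>j. u (j + 1) = f (u j)"
    proof
      fix j
      show "u (j + 1) = f (u j)"
      proof (cases "j \<ge> 0")
        case True
        then have "nat (j + 1) = Suc (nat j)"
          by simp
        with True show ?thesis
          by (simp add: u_def)
      next
        case False
        then have j: "nat (- j) = Suc (nat (- (j + 1)))"
          by simp
        have "f (u j) = (h ^^ nat (- (j + 1))) x"
          using False by (simp add: u_def j fh hn del: minus_add_distrib)
        also have "\<dots> = u (j + 1)"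
          using False by (cases "j = - 1") (auto simp: u_def)
        finally show ?thesis ..
      qed
    qed
  qed
qed

text \<open>The map \<open>j \<mapsto> nat \<bar>j\<bar>\<close> is injective on the nonnegative and
  on the negative indices, so each half contributes at most \<open>suminf h\<close>.\<close>

lemma two_sided_sum_bound:
  fixes q :: "int \<Rightarrow> real"
  assumes q: "\<And>j. q j \<le> h (nat \<bar>j\<bar>)" and h: "summable h" "\<And>n. 0 \<le> h n" and F: "finite F"
  shows "sum q F \<le> 2 * suminf h"
proof -
  have part: "sum q G \<le> suminf h" if G: "finite G" "inj_on (\<lambda>j. nat \<bar>j\<bar>) G" for G
  proof -
    have "sum q G \<le> (\<Sum>j\<in>G. h (nat \<bar>j\<bar>))"
      by (intro sum_mono q)
    also have "\<dots> = sum h ((\<lambda>j. nat \<bar>j\<bar>) ` G)"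
      by (simp add: sum.reindex[OF G(2)])
    also have "\<dots> \<le> suminf h"
      using G(1) h by (intro sum_le_suminf) auto
    finally show ?thesis .
  qed
  have "sum q F = sum q {j\<in>F. j \<ge> 0} + sum q {j\<in>F. \<not> j \<ge> 0}"
    using F by (subst sum.union_disjoint[symmetric]) (auto intro: arg_cong[of _ _ "sum q"])
  also have "\<dots> \<le> suminf h + suminf h"
    using F by (intro add_mono part) (auto simp: inj_on_def)
  finally show ?thesis
    by simp
qed

text \<open>
  \<open>\<eta>\<close> is the second fixed point of the Moebius map behind the recursion. The coordinate
  \<open>(z - \<omega>) / (z - \<eta>)\<close> (or \<open>1 / (z - \<omega>)\<close> if \<open>\<omega> = \<eta>\<close>) turns this map into a dilation
  (or a translation).
\<close>
lemma Moebius_orbit: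
  fixes u :: "int \<Rightarrow> complex"
  assumes u: "\<And>j. u j \<in> unit_disc" "u 0 = 0"
    and step: "\<And>j. u (j + 1) * (1 + cnj a * l * u j) = l * u j + a"
    and a: "cmod a < 1" and l: "cmod l = 1"
    and w: "cmod \<omega> = 1" "(\<lambda>n. u (int n)) \<longlonglongrightarrow> \<omega>"
  obtains \<eta> B where "cmod \<eta> = 1" "\<And>F. finite F \<Longrightarrow> (\<Sum>j\<in>F. cmod ((u j - \<omega>) * (u j - \<eta>))) \<le> B"
    "\<And>j. j \<noteq> 0 \<Longrightarrow> u j \<noteq> 0"
proof -
  have norm_lt: "cmod (cnj a * l * z) < 1" if "cmod z \<le> 1" for z
  proof -
    have "cmod (cnj a * l * z) = cmod a * cmod z"
      by (simp add: norm_mult l)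
    also have "\<dots> \<le> cmod a"
      using that by (intro mult_left_le) auto
    finally show ?thesis
      using a by linarith
  qed
  have D: "1 + cnj a * l * z \<noteq> 0" if "cmod z \<le> 1" for z
    using norm_lt[OF that] by (auto dest!: arg_cong[of _ _ cmod] simp: add_eq_0_iff)
  have E: "1 - z * cnj a \<noteq> 0" if "cmod z = 1" for z
  proof
    assume "1 - z * cnj a = 0"
    then have "cmod (z * cnj a) = 1"
      by simp
    then show False
      using a that by (simp add: norm_mult)
  qed
  have l0: "l \<noteq> 0" and w0: "\<omega> \<noteq> 0"
    using l w(1) by auto
  have fix_w: "\<omega> * (1 + cnj a * l * \<omega>) = l * \<omega> + a"
  proof (rule LIMSEQ_unique)
    have "(\<lambda>n. u (int (Suc n))) \<longlonglongrightarrow> \<omega>"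
      using LIMSEQ_Suc[OF w(2)] by simp
    then show "(\<lambda>n. u (int (Suc n)) * (1 + cnj a * l * u (int n))) \<longlonglongrightarrow> \<omega> * (1 + cnj a * l * \<omega>)"
      by (intro tendsto_intros w(2))
    have "u (int (Suc n)) * (1 + cnj a * l * u (int n)) = l * u (int n) + a" for n
      using step[of "int n"] by (simp add: add.commute)
    then show "(\<lambda>n. u (int (Suc n)) * (1 + cnj a * l * u (int n))) \<longlonglongrightarrow> l * \<omega> + a"
      by (simp only:) (intro tendsto_intros w(2))
  qed
  have a0: "a \<noteq> 0"
  proof
    assume a_eq: "a = 0"
    have "u (int n) = 0" for n
    proof (induction n)
      case (Suc n)
      then show ?case
        using step[of "int n"] a_eq by (simp add: add.commute)
    qed (simp add: u(2))
    then have "\<omega> = 0"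
      using w(2) by (simp add: LIMSEQ_const_iff)
    with w0 show False
      by simp
  qed
  \<comment> \<open>Fixed points solve \<open>cnj a * l * x\<^sup>2 + (1 - l) * x - a = 0\<close>.
    The second root comes from the product of the roots; \<open>sum0\<close> below is the matching
    relation for their sum.\<close>
  define \<eta> where "\<eta> = - a / (cnj a * l * \<omega>)"
  have h1: "cmod \<eta> = 1"
    using a0 by (simp add: \<eta>_def norm_divide norm_mult l w(1))
  have prod: "cnj a * l * \<omega> * \<eta> = - a"
    using a0 l0 w0 by (simp add: \<eta>_def)
  have "\<omega> * (1 - l + cnj a * l * (\<omega> + \<eta>)) = \<omega> * (1 + cnj a * l * \<omega>) - l * \<omega> + cnj a * l * \<omega> * \<eta>"
    by (simp add: algebra_simps)
  also have "\<dots> = 0"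
    unfolding fix_w prod by simp
  finally have sum0: "1 - l + cnj a * l * (\<omega> + \<eta>) = 0"
    using w0 by simp
  have fix_h: "\<eta> * (1 + cnj a * l * \<eta>) = l * \<eta> + a"
  proof -
    have "\<eta> * (1 + cnj a * l * \<eta>) = \<eta> * (1 - l + cnj a * l * (\<omega> + \<eta>)) + l * \<eta> - cnj a * l * \<omega> * \<eta>"
      by (simp add: algebra_simps)
    then show ?thesis
      unfolding sum0 prod by simp
  qed
  have diff: "(u (j + 1) - x) * (1 + cnj a * l * u j) = l * (1 - x * cnj a) * (u j - x)"
    if "x * (1 + cnj a * l * x) = l * x + a" for x j
  proof -
    have "(u (j + 1) - x) * (1 + cnj a * l * u j) = l * u j + a - x * (1 + cnj a * l * u j)"
      by (simp only: left_diff_distrib step)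
    also have "\<dots> = l * (1 - x * cnj a) * (u j - x) + (l * x + a - x * (1 + cnj a * l * x))"
      by (simp add: algebra_simps)
    finally show ?thesis
      by (simp add: that)
  qed
  have ne: "u j - x \<noteq> 0" and le2: "cmod (u j - x) \<le> 2" if "cmod x = 1" for j x
  proof -
    show "u j - x \<noteq> 0"
      using u(1)[of j] that by auto
    show "cmod (u j - x) \<le> 2"
      using norm_triangle_ineq4[of "u j" x] u(1)[of j] that by simp
  qed
  show thesis
  proof (cases "\<omega> = \<eta>")
    case False
    \<comment> \<open>The multiplier is the quotient of the two constants in \<open>diff\<close>;
      the common denominator \<open>1 + cnj a * l * u j\<close> cancels. Convergence of the forward
      orbit to \<omega> then forces \<open>cmod k < 1\<close>.\<close>
    define k where "k = (1 - \<omega> * cnj a) / (1 - \<eta> * cnj a)"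
    define t where "t j = (u j - \<omega>) / (u j - \<eta>)" for j
    have k0: "k \<noteq> 0"
      using E[OF w(1)] E[OF h1] by (simp add: k_def)
    have t_step: "t (j + 1) = k * t j" for j
    proof -
      have Dj: "1 + cnj a * l * u j \<noteq> 0"
        using u(1)[of j] by (intro D) simp
      then have "t (j + 1) = ((u (j + 1) - \<omega>) * (1 + cnj a * l * u j)) / ((u (j + 1) - \<eta>) * (1 + cnj a * l * u j))"
        by (simp add: t_def)
      also have "\<dots> = k * t j"
        unfolding diff[OF fix_w] diff[OF fix_h] using l0 by (simp add: k_def t_def)
      finally show ?thesis .
    qed
    have t0: "cmod (t 0) = 1"
      by (simp add: t_def u(2) norm_divide w(1) h1)
    have t_pos: "cmod (t (int n)) = cmod k ^ n" for n
    proof (induction n)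
      case (Suc n)
      then show ?case
        using t_step[of "int n"] by (simp add: add.commute norm_mult)
    qed (simp add: t0)
    have t_neg: "cmod (t (- int n)) * cmod k ^ n = 1" for n
    proof (induction n)
      case (Suc n)
      have "t (- int n) = k * t (- int (Suc n))"
        using t_step[of "- int (Suc n)"] by simp
      with Suc show ?case
        by (simp add: norm_mult mult_ac)
    qed (simp add: t0)
    have "(\<lambda>n. t (int n)) \<longlonglongrightarrow> (\<omega> - \<omega>) / (\<omega> - \<eta>)"
      unfolding t_def using False by (intro tendsto_intros w(2)) auto
    then have lim: "(\<lambda>n. cmod k ^ n) \<longlonglongrightarrow> 0"
      using tendsto_norm_zero[of "\<lambda>n. t (int n)"] by (simp add: t_pos)
    have k1: "cmod k < 1"
    proof (rule ccontr)
      assume "\<not> cmod k < 1"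
      then have "1 \<le> cmod k ^ n" for n
        by (simp add: one_le_power)
      then show False
        using LIMSEQ_le_const[OF lim, of 1] by simp
    qed
    \<comment> \<open>Forward in time the factor at \<omega> is the small one, backward in time the
      factor at \<eta>; in both cases the other distance is at most 2.\<close>
    have q_le: "cmod ((u j - \<omega>) * (u j - \<eta>)) \<le> 4 * cmod k ^ nat \<bar>j\<bar>" for j
    proof -
      obtain n where "j = int n \<or> j = - int n"
        by (cases j rule: int_cases2) auto
      then show ?thesis
      proof
        assume j: "j = int n"
        have "cmod (u j - \<omega>) = cmod k ^ n * cmod (u j - \<eta>)"
          using t_pos[of n] ne[OF h1, of j] j by (simp add: t_def norm_divide field_simps)
        then have "cmod ((u j - \<omega>) * (u j - \<eta>)) = cmod k ^ n * (cmod (u j - \<eta>) * cmod (u j - \<eta>))"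
          by (simp add: norm_mult)
        also have "\<dots> \<le> cmod k ^ n * (2 * 2)"
          by (intro mult_left_mono mult_mono le2 h1) auto
        finally show ?thesis
          using j by simp
      next
        assume j: "j = - int n"
        have "cmod (u j - \<eta>) = cmod k ^ n * cmod (u j - \<omega>)"
          using t_neg[of n] ne[OF h1, of j] j by (simp add: t_def norm_divide field_simps)
        then have "cmod ((u j - \<omega>) * (u j - \<eta>)) = cmod k ^ n * (cmod (u j - \<omega>) * cmod (u j - \<omega>))"
          by (simp add: norm_mult)
        also have "\<dots> \<le> cmod k ^ n * (2 * 2)"
          by (intro mult_left_mono mult_mono le2 w(1)) auto
        finally show ?thesis
          using j by simp
      qed
    qed
    show thesis
    proof (rule that[OF h1])
      show "(\<Sum>j\<in>F. cmod ((u j - \<omega>) * (u j - \<eta>))) \<le> 2 * (\<Sum>n. 4 * cmod k ^ n)" if "finite F" for F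
        using k1
        by (intro two_sided_sum_bound[where h = "\<lambda>n. 4 * cmod k ^ n"] that q_le
            summable_mult summable_geometric) auto
      show "u j \<noteq> 0" if "j \<noteq> 0" for j
      proof
        assume "u j = 0"
        then have tj: "cmod (t j) = 1"
          using t0 by (simp add: t_def u(2))
        obtain n where n: "j = int n \<or> j = - int n"
          by (cases j rule: int_cases2) auto
        then have "cmod k ^ n = 1"
          using t_pos[of n] t_neg[of n] tj by auto
        moreover have "cmod k ^ n < 1"
          using power_strict_decreasing[of 0 n "cmod k"] k0 k1 n that by auto
        ultimately show False
          by simp
      qed
    qed
  next
    case True
    define k where "k = cnj a / (1 - \<omega> * cnj a)"
    define s where "s j = 1 / (u j - \<omega>)" for j
    have k0: "k \<noteq> 0"
      using E[OF w(1)] a0 by (simp add: k_def)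
    have s_step: "s (j + 1) = s j + k" for j
    proof -
      have Dj: "1 + cnj a * l * u j \<noteq> 0"
        using u(1)[of j] by (intro D) simp
      \<comment> \<open>For a double root, \<open>sum0\<close> reads
        \<open>1 - l + 2 * cnj a * l * \<omega> = 0\<close>. Dividing the two summands by the right
        side of \<open>diff\<close> gives \<open>s j\<close> and the translation length
        \<open>k\<close>.\<close>
      have "1 + cnj a * l * u j = l * (1 - \<omega> * cnj a) + cnj a * l * (u j - \<omega>)"
        using sum0 True by (simp add: algebra_simps)
      then have "s (j + 1) = (l * (1 - \<omega> * cnj a) + cnj a * l * (u j - \<omega>)) / ((u (j + 1) - \<omega>) * (1 + cnj a * l * u j))"
        using Dj by (simp add: s_def)
      also have "\<dots> = s j + k"
        unfolding diff[OF fix_w] using l0 E[OF w(1)] ne[OF w(1), of j]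
        by (simp add: k_def s_def add_divide_distrib)
      finally show ?thesis .
    qed
    have s_eq: "s j = s 0 + of_int j * k" for j
    proof (induction j rule: int_induct[where k = 0])
      case (step1 i)
      show ?case
        unfolding s_step step1(2) by (simp add: algebra_simps)
    next
      case (step2 i)
      then show ?case
        using s_step[of "i - 1"] by (simp add: algebra_simps)
    qed simp
    have s0: "cmod (s 0) = 1"
      by (simp add: s_def u(2) norm_divide w(1))
    \<comment> \<open>From \<open>cmod (u j - \<omega>) \<le> 2\<close> comes
      \<open>1 \<le> 2 * cmod (s j)\<close>. Hence \<open>\<bar>j\<bar> * cmod k \<le> cmod (s j) +
      1 \<le> 3 * cmod (s j)\<close>, and the additional 1 in \<open>Suc\<close> costs another
      \<open>2 * cmod (s j)\<close>.\<close>
    define C where "C = 3 / cmod k + 2"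
    have q_le: "cmod ((u j - \<omega>) * (u j - \<eta>)) \<le> C\<^sup>2 * (1 / (real (Suc (nat \<bar>j\<bar>)))\<^sup>2)" for j
    proof -
      have sj: "cmod (s j) > 0" "2 * cmod (s j) \<ge> 1"
        using ne[OF w(1), of j] le2[OF w(1), of j] by (auto simp: s_def norm_divide field_simps)
      have "of_int j * k = s j - s 0"
        by (simp add: s_eq[of j])
      then have "real_of_int \<bar>j\<bar> * cmod k = cmod (s j - s 0)"
        by (metis norm_mult norm_of_int of_int_abs)
      also have "\<dots> \<le> 3 * cmod (s j)"
        using norm_triangle_ineq4[of "s j" "s 0"] s0 sj(2) by simp
      finally have "real_of_int \<bar>j\<bar> \<le> 3 / cmod k * cmod (s j)"
        using k0 by (simp add: field_simps)
      then have "real (Suc (nat \<bar>j\<bar>)) \<le> C * cmod (s j)"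
        using sj(2) by (simp add: C_def distrib_right)
      then have "(real (Suc (nat \<bar>j\<bar>)))\<^sup>2 \<le> (C * cmod (s j))\<^sup>2"
        by (intro power_mono) auto
      then have "1 / (cmod (s j))\<^sup>2 \<le> C\<^sup>2 * (1 / (real (Suc (nat \<bar>j\<bar>)))\<^sup>2)"
        using sj(1) by (simp add: power_mult_distrib field_simps)
      moreover have "cmod ((u j - \<omega>) * (u j - \<eta>)) = 1 / (cmod (s j))\<^sup>2"
        using True by (simp add: s_def norm_mult norm_divide power2_eq_square)
      ultimately show ?thesis
        by simp
    qed
    have summ: "summable (\<lambda>n. C\<^sup>2 * (1 / (real (Suc n))\<^sup>2))"
      using inverse_power_summable[of 2, where 'a = real] summable_Suc_iff[of "\<lambda>n. 1 / (real n)\<^sup>2"]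
      by (intro summable_mult) (simp add: inverse_eq_divide del: of_nat_Suc)
    show thesis
    proof (rule that[OF h1])
      show "(\<Sum>j\<in>F. cmod ((u j - \<omega>) * (u j - \<eta>))) \<le> 2 * (\<Sum>n. C\<^sup>2 * (1 / (real (Suc n))\<^sup>2))"
        if "finite F" for F
        by (intro two_sided_sum_bound[where h = "\<lambda>n. C\<^sup>2 * (1 / (real (Suc n))\<^sup>2)"] that q_le summ) simp
      show "u j \<noteq> 0" if "j \<noteq> 0" for j
      proof
        assume "u j = 0"
        then have "s j = s 0"
          by (simp add: s_def u(2))
        then show False
          using s_eq[of j] k0 that by simp
      qed
    qed
  qed
qed

section \<open>Telescoping along a weighted orbit\<close>

lemma sum_telescope_int:
  fixes A :: "int \<Rightarrow> 'a::ab_group_add"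
  shows "(\<Sum>j\<in>{- int N..<int N}. A j - A (j + 1)) = A (- int N) - A (int N)"
proof (induction N)
  case (Suc N)
  have "{- int (Suc N)..<int (Suc N)} = insert (int N) (insert (- int (Suc N)) {- int N..<int N})"
    by auto
  then show ?case
    using Suc by (simp add: algebra_simps)
qed simp

context kernel_identity
begin

text \<open>\<open>P j\<close> is the product of the weights \<open>\<psi> / c\<close> along the
  orbit, continued to negative \<open>j\<close> by division; for \<open>j \<ge> 0\<close>,
  \<open>P j * f (u j)\<close> is \<open>c\<close> to the power \<open>- j\<close> times the value
  of \<open>W ^^ j\<close> applied to \<open>f\<close> at 0. Its modulus follows from
  \<open>weight_norm\<close> by induction in both directions.\<close>

lemma weighted_orbit:
  assumes c: "cmod c = 1"
  obtains u P :: "int \<Rightarrow> complex" where "u 0 = 0" "P 0 = 1" "\<And>j. u j \<in> unit_disc"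
    "\<And>j. u (j + 1) = \<phi> (u j)" "\<And>j. P (j + 1) = P j * (\<psi> (u j) / c)"
    "\<And>j. cmod (P j) = sqrt (1 - (cmod (u j))\<^sup>2)"
proof -
  have c0: "c \<noteq> 0"
    using c by auto
  define h where "h = inv_into unit_disc \<phi>"
  have h: "h z \<in> unit_disc" "\<phi> (h z) = z" if "z \<in> unit_disc" for z
    using bij_disc that inv_into_into[of z \<phi> unit_disc] f_inv_into_f[of z \<phi> unit_disc]
    unfolding h_def bij_betw_def by auto
  have hphi: "h (\<phi> z) = z" if "z \<in> unit_disc" for z
    using bij_disc that unfolding h_def bij_betw_def by (simp add: inv_into_f_f)
  \<comment> \<open>The skew product carries the orbit point and the accumulated weight together. It
    is a bijection of the disc times the nonzero numbers, so a single two-sided orbit yields both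
    \<open>u\<close> and \<open>P\<close>.\<close>
  let ?f = "\<lambda>(z, q). (\<phi> z, q * (\<psi> z / c))"
  have bij: "bij_betw ?f (unit_disc \<times> - {0}) (unit_disc \<times> - {0})"
  proof (rule bij_betw_byWitness[where f' = "\<lambda>(z, q). (h z, q / (\<psi> (h z) / c))"])
    show "\<forall>x\<in>unit_disc \<times> - {0}. (\<lambda>(z, q). (h z, q / (\<psi> (h z) / c))) (?f x) = x"
      using weight_neq_0 c0 hphi by auto
    show "\<forall>x\<in>unit_disc \<times> - {0}. ?f ((\<lambda>(z, q). (h z, q / (\<psi> (h z) / c))) x) = x"
      using weight_neq_0 c0 h by auto
    show "?f ` (unit_disc \<times> - {0}) \<subseteq> unit_disc \<times> - {0}"
      using weight_neq_0 c0 maps_to_disc by auto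
    show "(\<lambda>(z, q). (h z, q / (\<psi> (h z) / c))) ` (unit_disc \<times> - {0}) \<subseteq> unit_disc \<times> - {0}"
      using weight_neq_0 c0 h by auto
  qed
  have "(0, 1) \<in> unit_disc \<times> - {0 :: complex}"
    by simp
  then obtain v :: "int \<Rightarrow> complex \<times> complex" where v: "v 0 = (0, 1)" "\<forall>j. v j \<in> unit_disc \<times> - {0}" "\<forall>j. v (j + 1) = ?f (v j)"
    by (rule two_sided_orbit[OF bij])
  define u P where "u j = fst (v j)" and "P j = snd (v j)" for j
  have u: "u j \<in> unit_disc" for j
    using spec[OF v(2), of j] by (auto simp: u_def)
  have step: "u (j + 1) = \<phi> (u j)" "P (j + 1) = P j * (\<psi> (u j) / c)" for j
    using spec[OF v(3), of j] by (auto simp: u_def P_def split: prod.splits)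
  have P_step: "(cmod (P (j + 1)))\<^sup>2 = (cmod (P j))\<^sup>2 * (cmod (\<psi> (u j)))\<^sup>2" for j
    by (simp add: step norm_mult norm_divide c power_mult_distrib)
  have sq: "(cmod (P j))\<^sup>2 = 1 - (cmod (u j))\<^sup>2" for j
  proof (induction j rule: int_induct[where k = 0])
    case base
    show ?case
      by (simp add: u_def P_def v(1))
  next
    case (step1 i)
    have "(cmod (P (i + 1)))\<^sup>2 = (cmod (\<psi> (u i)))\<^sup>2 * (1 - (cmod (u i))\<^sup>2)"
      using step1(2) by (simp add: P_step)
    then show ?case
      by (simp only: weight_norm[OF u] step(1))
  next
    case (step2 i)
    have "(cmod (\<psi> (u (i - 1))))\<^sup>2 * (cmod (P (i - 1)))\<^sup>2 = 1 - (cmod (u i))\<^sup>2"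
      using P_step[of "i - 1"] step2(2) by (simp add: mult.commute)
    also have "\<dots> = (cmod (\<psi> (u (i - 1))))\<^sup>2 * (1 - (cmod (u (i - 1)))\<^sup>2)"
      using step(1)[of "i - 1"] weight_norm[OF u, of "i - 1"] by simp
    finally have "(cmod (\<psi> (u (i - 1))))\<^sup>2 * (cmod (P (i - 1)))\<^sup>2
        = (cmod (\<psi> (u (i - 1))))\<^sup>2 * (1 - (cmod (u (i - 1)))\<^sup>2)" .
    moreover have "(cmod (\<psi> (u (i - 1))))\<^sup>2 \<noteq> 0"
      using weight_neq_0[OF u, of "i - 1"] by simp
    ultimately show ?case
      by (metis mult_left_cancel)
  qed
  show thesis
  proof (rule that[of u P])
    show "cmod (P j) = sqrt (1 - (cmod (u j))\<^sup>2)" for j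
      by (simp flip: sq)
  qed (use v(1) u step in \<open>auto simp: u_def P_def\<close>)
qed

text \<open>
  The test function is a polynomial that vanishes at the finitely many orbit points at which
  \<open>(z - \<omega>) (z - \<eta>)\<close> is not small, and to high order at \<open>\<omega>\<close> and \<open>\<eta>\<close>, so that the orbit
  point \<open>0\<close> dominates the bilateral sum.
\<close>
lemma nonelliptic_in_spectrum:
  assumes W: "H2_unitary (weighted_comp \<psi> \<phi>)" and dw: "denjoy_wolff_point \<phi> \<omega>"
    and c: "cmod c = 1"
  shows "c \<in> H2_spectrum (weighted_comp \<psi> \<phi>)"
proof (rule ccontr)
  assume "c \<notin> H2_spectrum (weighted_comp \<psi> \<phi>)"
  then obtain S where S: "H2_bounded_op S"
    and inv: "\<forall>f\<in>H2. (\<lambda>z. c * S f z - weighted_comp \<psi> \<phi> (S f) z) = f"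
    by (rule H2_not_in_spectrumE)
  obtain u P :: "int \<Rightarrow> complex" where u0: "u 0 = 0" and P0: "P 0 = 1" and u: "\<And>j. u j \<in> unit_disc"
    and u_step: "\<And>j. u (j + 1) = \<phi> (u j)" and P_step: "\<And>j. P (j + 1) = P j * (\<psi> (u j) / c)"
    and P_norm: "\<And>j. cmod (P j) = sqrt (1 - (cmod (u j))\<^sup>2)"
    by (rule weighted_orbit[OF c]) blast
  obtain l where l: "cmod l = 1"
    and Mf: "\<And>z. z \<in> unit_disc \<Longrightarrow> \<phi> z * (1 + cnj (\<phi> 0) * l * z) = l * z + \<phi> 0"
    by (rule Moebius_form) blast
  have w1: "cmod \<omega> = 1"
    using dw by (simp add: denjoy_wolff_point_def)
  have u_pow: "u (int n) = (\<phi> ^^ n) 0" for n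
  proof (induction n)
    case (Suc n)
    then show ?case
      using u_step[of "int n"] by (simp add: add.commute)
  qed (simp add: u0)
  have lim: "(\<lambda>n. u (int n)) \<longlonglongrightarrow> \<omega>"
    unfolding u_pow using dw by (simp add: denjoy_wolff_point_def)
  have step': "u (j + 1) * (1 + cnj (\<phi> 0) * l * u j) = l * u j + \<phi> 0" for j
    unfolding u_step by (rule Mf[OF u])
  have phi0: "cmod (\<phi> 0) < 1"
    using maps_to_disc[of 0] by simp
  obtain \<eta> B where h1: "cmod \<eta> = 1"
    and B: "\<And>F. finite F \<Longrightarrow> (\<Sum>j\<in>F. cmod ((u j - \<omega>) * (u j - \<eta>))) \<le> B"
    and u_ne: "\<And>j. j \<noteq> 0 \<Longrightarrow> u j \<noteq> 0"
    by (rule Moebius_orbit[OF u u0 step' phi0 l w1 lim]) blast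
  define q where "q j = cmod ((u j - \<omega>) * (u j - \<eta>))" for j
  have qB: "sum q F \<le> B" if "finite F" for F
    using B[OF that] by (simp add: q_def)
  \<comment> \<open>Both \<omega> and \<eta> lie on the circle, at distance at least
    \<open>1 - cmod (u j)\<close> from \<open>u j\<close>. Bounded sums of \<open>q\<close>
    therefore push the orbit to the circle in both directions; the injection \<open>i\<close> below
    covers both.\<close>
  have q_lower: "(1 - cmod (u j))\<^sup>2 \<le> q j" for j
  proof -
    have "1 - cmod (u j) \<le> cmod (u j - \<omega>)" "1 - cmod (u j) \<le> cmod (u j - \<eta>)"
      using norm_triangle_ineq2[of \<omega> "u j"] norm_triangle_ineq2[of \<eta> "u j"] w1 h1
      by (simp_all add: norm_minus_commute)
    then show ?thesis
      unfolding q_def norm_mult power2_eq_square using u[of j] by (intro mult_mono) auto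
  qed
  have to_circle: "(\<lambda>n. cmod (u (i n))) \<longlonglongrightarrow> 1" if i: "inj i" for i :: "nat \<Rightarrow> int"
  proof -
    have "summable (\<lambda>n. q (i n))"
    proof (rule bounded_imp_summable[where B = B])
      show "(\<Sum>k\<le>n. q (i k)) \<le> B" for n
        using qB[of "i ` {..n}"] i by (simp add: sum.reindex inj_on_subset)
    qed (simp add: q_def)
    then have q0: "(\<lambda>n. q (i n)) \<longlonglongrightarrow> 0"
      by (rule summable_LIMSEQ_zero)
    have "(\<lambda>n. (1 - cmod (u (i n)))\<^sup>2) \<longlonglongrightarrow> 0"
      by (rule Lim_null_comparison[OF always_eventually q0]) (simp add: q_lower)
    from tendsto_real_sqrt[OF this] have "(\<lambda>n. 1 - cmod (u (i n))) \<longlonglongrightarrow> 0"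
      unfolding real_sqrt_abs real_sqrt_zero by (rule tendsto_rabs_zero_cancel)
    from tendsto_diff[OF tendsto_const[of 1] this] show ?thesis
      by simp
  qed
  \<comment> \<open>With \<open>g\<close> solving \<open>c g - W g = f\<close>, the numbers
    \<open>P j * g (u j)\<close> have differences \<open>P j * f (u j) / c\<close> and tend to 0 at
    both ends by boundary decay. So the bilateral sum of \<open>P j * f (u j)\<close> vanishes, and
    its term at index 0 is bounded by the others.\<close>
  have dominated: "cmod (f 0) \<le> C"
    if f: "f \<in> H2" and C: "\<And>F. finite F \<Longrightarrow> 0 \<notin> F \<Longrightarrow> (\<Sum>j\<in>F. cmod (f (u j))) \<le> C" for f C
  proof -
    define g where "g = S f"
    have g: "g \<in> H2"
      unfolding g_def by (rule H2_bounded_opD(1)[OF S f])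
    have geq: "c * g z - \<psi> z * g (\<phi> z) = f z" if "z \<in> unit_disc" for z
      using fun_cong[OF bspec[OF inv f], of z] that by (simp add: g_def weighted_comp_def)
    define A where "A j = P j * g (u j)" for j
    have c0: "c \<noteq> 0"
      using c by auto
    have A_diff: "A j - A (j + 1) = P j * f (u j) / c" for j
      unfolding A_def geq[OF u, symmetric] u_step P_step using c0 by (simp add: field_simps)
    have A_lim: "(\<lambda>n. A (i n)) \<longlonglongrightarrow> 0" if i: "inj i" for i :: "nat \<Rightarrow> int"
    proof (rule tendsto_norm_zero_cancel)
      show "(\<lambda>n. cmod (A (i n))) \<longlonglongrightarrow> 0"
        using H2_boundary_decay[OF g u to_circle[OF i]] by (simp add: A_def norm_mult P_norm mult.commute)
    qed
    \<comment> \<open>Positivity of \<open>N\<close> ensures that index 0 lies in the half-open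
      summation range and can be split off.\<close>
    have bound: "cmod (f 0) \<le> cmod (A (- int N)) + cmod (A (int N)) + C" if N: "N > 0" for N
    proof -
      let ?F = "{- int N..<int N} - {0}"
      have "(\<Sum>j\<in>{- int N..<int N}. P j * f (u j) / c) = A (- int N) - A (int N)"
        unfolding A_diff[symmetric] by (rule sum_telescope_int)
      moreover have "(\<Sum>j\<in>{- int N..<int N}. P j * f (u j) / c) = f 0 / c + (\<Sum>j\<in>?F. P j * f (u j) / c)"
        using N by (subst sum.remove[of _ 0]) (auto simp: u0 P0)
      ultimately have "f 0 / c = A (- int N) - A (int N) - (\<Sum>j\<in>?F. P j * f (u j) / c)"
        by (simp add: algebra_simps)
      then have "cmod (f 0) = cmod (A (- int N) - A (int N) - (\<Sum>j\<in>?F. P j * f (u j) / c))"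
        using c by (metis div_by_1 norm_divide)
      also have "\<dots> \<le> cmod (A (- int N)) + cmod (A (int N)) + cmod (\<Sum>j\<in>?F. P j * f (u j) / c)"
        by (intro order_trans[OF norm_triangle_ineq4] add_mono norm_triangle_ineq4 order_refl)
      also have "cmod (\<Sum>j\<in>?F. P j * f (u j) / c) \<le> (\<Sum>j\<in>?F. cmod (f (u j)))"
      proof (rule sum_norm_le)
        fix j
        have "cmod (P j) \<le> 1"
          using u[of j] by (simp add: P_norm power_le_one)
        then show "cmod (P j * f (u j) / c) \<le> cmod (f (u j))"
          by (simp add: norm_mult norm_divide c mult_left_le_one_le)
      qed
      also have "\<dots> \<le> C"
        by (rule C) auto
      finally show ?thesis
        by simp
    qed
    have "(\<lambda>N. cmod (A (- int N)) + cmod (A (int N)) + C) \<longlonglongrightarrow> 0 + 0 + C"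
      by (intro tendsto_add tendsto_const tendsto_norm_zero A_lim) (auto simp: inj_def)
    then show ?thesis
      using bound by (intro LIMSEQ_le_const) (auto intro!: exI[of _ 1])
  qed
  define J where "J = {j. j \<noteq> 0 \<and> 1 / 2 \<le> q j}"
  \<comment> \<open>Each index in \<open>J\<close> contributes at least 1/2 to a sum bounded by
    \<open>B\<close>, so finite subsets of \<open>J\<close> have at most \<open>2 * B\<close>
    elements.\<close>
  have J: "finite J"
  proof (rule ccontr)
    assume "infinite J"
    obtain F where F: "F \<subseteq> J" "finite F" "card F = nat \<lceil>2 * B\<rceil> + 1"
      using infinite_arbitrarily_large[OF \<open>infinite J\<close>] by blast
    have "real (card F) * (1 / 2) \<le> sum q F"
      using F(1) sum_bounded_below[of F "1 / 2" q] by (auto simp: J_def)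
    with qB[OF F(2)] have "real (card F) \<le> 2 * B"
      by simp
    then show False
      unfolding F(3) by linarith
  qed
  define Q where "Q z = (\<Prod>j\<in>J. z - u j)" for z
  define D where "D = (2::real) ^ card J"
  have Q_le: "cmod (Q z) \<le> D" if "z \<in> unit_disc" for z
  proof -
    have "cmod (z - u j) \<le> 2" for j
      using norm_triangle_ineq4[of z "u j"] u[of j] that by simp
    then have "(\<Prod>j\<in>J. cmod (z - u j)) \<le> (\<Prod>j\<in>J. 2)"
      by (intro prod_mono) auto
    then show ?thesis
      by (simp add: Q_def D_def prod_norm)
  qed
  have Q0: "Q 0 \<noteq> 0"
    using J u_ne by (auto simp: Q_def J_def)
  have small: "cmod (Q 0) \<le> D * B * (1 / 2) ^ m" for m
  proof -
    \<comment> \<open>Off \<open>J\<close> and away from index 0, \<open>m\<close> of the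
      \<open>Suc m\<close> factors contribute at most 1/2 each, while the remaining one is kept as
      \<open>q j\<close> to make the sum over the orbit converge. At 0 the power has modulus 1, so
      \<open>cmod (f 0)\<close> does not shrink with \<open>m\<close>.\<close>
    define f where "f z = (if z \<in> unit_disc then ((z - \<omega>) * (z - \<eta>)) ^ Suc m * Q z else 0)" for z
    have fH: "f \<in> H2"
      unfolding f_def Q_def by (rule H2_restrict[where r = 2]) (intro holomorphic_intros, simp)
    have "cmod (f 0) \<le> D * B * (1 / 2) ^ m"
    proof (rule dominated[OF fH])
      fix F :: "int set"
      assume F: "finite F" "0 \<notin> F"
      have "cmod (f (u j)) \<le> D * (1 / 2) ^ m * q j" if j: "j \<in> F" for j
      proof (cases "j \<in> J")
        case True
        then have "Q (u j) = 0"
          using J by (auto simp: Q_def)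
        then show ?thesis
          by (simp add: f_def q_def D_def)
      next
        case False
        then have "q j \<le> 1 / 2"
          using j F(2) by (auto simp: J_def)
        then have "q j ^ m \<le> (1 / 2) ^ m"
          by (intro power_mono) (auto simp: q_def)
        then have "q j ^ m * q j * cmod (Q (u j)) \<le> (1 / 2) ^ m * q j * D"
          using Q_le[OF u] by (intro mult_mono) (auto simp: q_def)
        moreover have "cmod (f (u j)) = q j ^ m * q j * cmod (Q (u j))"
          using u[of j] by (simp add: f_def q_def norm_mult norm_power)
        ultimately show ?thesis
          by (simp add: mult_ac)
      qed
      then have "(\<Sum>j\<in>F. cmod (f (u j))) \<le> (\<Sum>j\<in>F. D * (1 / 2) ^ m * q j)"
        by (rule sum_mono)
      also have "\<dots> = D * (1 / 2) ^ m * sum q F"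
        by (simp add: sum_distrib_left)
      also have "\<dots> \<le> D * (1 / 2) ^ m * B"
        by (intro mult_left_mono qB F(1)) (simp add: D_def)
      finally show "(\<Sum>j\<in>F. cmod (f (u j))) \<le> D * B * (1 / 2) ^ m"
        by (simp add: mult_ac)
    qed
    moreover have "cmod (f 0) = cmod (Q 0)"
      by (simp add: f_def norm_mult norm_power w1 h1)
    ultimately show ?thesis
      by simp
  qed
  have "(\<lambda>m. D * B * (1 / 2) ^ m) \<longlonglongrightarrow> D * B * 0"
    by (intro tendsto_mult tendsto_const LIMSEQ_power_zero) simp
  then have "cmod (Q 0) \<le> D * B * 0"
    by (rule LIMSEQ_le_const) (use small in blast)
  with Q0 show False
    by simp
qed

end

theorem theorem7:
  fixes \<phi> \<psi> :: "complex \<Rightarrow> complex"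
  assumes "\<phi> holomorphic_on unit_disc" and "\<phi> ` unit_disc \<subseteq> unit_disc"
    and "\<psi> holomorphic_on unit_disc"
    and "H2_unitary (weighted_comp \<psi> \<phi>)"
  shows "disc_automorphism \<phi>
    \<and> (\<forall>p\<in>unit_disc. elliptic \<phi> \<and> \<phi> p = p \<longrightarrow>
         cmod (deriv \<phi> p) = 1
         \<and> H2_spectrum (weighted_comp \<psi> \<phi>)
             = closure (range (\<lambda>n::nat. \<psi> p * deriv \<phi> p ^ n)))
    \<and> (hyperbolic \<phi> \<or> parabolic \<phi> \<longrightarrow>
         H2_spectrum (weighted_comp \<psi> \<phi>) = sphere 0 1)"
proof -
  interpret kernel_identity \<phi> \<psi>
    by (rule unitary_kernel_identity[OF assms(2,4)])
  have "disc_automorphism \<phi>"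
    using assms(1) bij_disc by (simp add: disc_automorphism_def)
  moreover have "cmod (deriv \<phi> p) = 1 \<and> H2_spectrum (weighted_comp \<psi> \<phi>)
      = closure (range (\<lambda>n::nat. \<psi> p * deriv \<phi> p ^ n))" if "p \<in> unit_disc" "\<phi> p = p" for p
    using fixpoint_deriv(1)[OF assms(1) that] elliptic_spectrum[OF assms(1,4) that] by (rule conjI)
  moreover have "H2_spectrum (weighted_comp \<psi> \<phi>) = sphere 0 1" if "hyperbolic \<phi> \<or> parabolic \<phi>"
  proof
    show "H2_spectrum (weighted_comp \<psi> \<phi>) \<subseteq> sphere 0 1"
      by (rule H2_unitary_spectrum_subset[OF assms(4)])
    obtain \<omega> where "denjoy_wolff_point \<phi> \<omega>"
      using \<open>hyperbolic \<phi> \<or> parabolic \<phi>\<close> unfolding hyperbolic_def parabolic_def by blast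
    then show "sphere 0 1 \<subseteq> H2_spectrum (weighted_comp \<psi> \<phi>)"
      using nonelliptic_in_spectrum[OF assms(4)] by (auto simp: dist_norm)
  qed
  ultimately show ?thesis
    by blast
qed

end
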